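(* Let $\mathcal{A}$ and $\mathcal{B}$ be presentations of a transversal matroid $M$. Then the set $$L_{\mathcal{A},\mathcal{B}}=\{I\in L_\mathcal{A}: M[\mathcal{A}^I]=M[\mathcal{B}^J]\text{ for some } J\in L_\mathcal{B}\}$$ is a sublattice of $L_\mathcal{A}$. The sublattices $L_{\mathcal{A},\mathcal{B}}$ of $L_\mathcal{A}$ and $L_{\mathcal{B},\mathcal{A}}$ of $L_\mathcal{B}$ are isomorphic, and $T_\mathcal{A}\cap T_\mathcal{B}$ is a sublattice of both $T_\mathcal{A}$ and $T_\mathcal{B}$.
   Context: Let $r=r(M)$ and $[r]=\{1,\dots,r\}$. For a set system $\mathcal{A}=(A_i:i\in[r])$ on a finite set $E$, $M[\mathcal{A}]$ is the transversal matroid on $E$ whose independent sets are the partial transversals of $\mathcal{A}$; $\mathcal{A}$ is a presentation of $M[\mathcal{A}]$, with exactly $r$ sets. Fix $x\notin E$; for $I\subseteq[r]$, $\mathcal{A}^I$ is obtained from $\mathcal{A}$ by replacing $A_i$ by $A_i\cup\{x\}$ for each $i\in I$. Let $\sigma_\mathcal{A}(I)=I\cup\{k\in[r]-I: x\text{ is a coloop of } M[\mathcal{A}^I]\backslash A_k\}$; $L_\mathcal{A}$ is the lattice (under inclusion; join $\cup$, meet $\cap$) of $I\subseteq[r]$ with $\sigma_\mathcal{A}(I)=I$. $T_\mathcal{A}=\{M[\mathcal{A}^I]: I\in L_\mathcal{A}\}$ ordered by the weak order ($N_1\le_w N_2$ iff every independent set of $N_1$ is independent in $N_2$); it is a lattice.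 Similarly $L_\mathcal{B}$, $T_\mathcal{B}$, and $L_{\mathcal{B},\mathcal{A}}$ (with roles of $\mathcal{A},\mathcal{B}$ swapped). *)

theory Defs
  imports "HOL-Algebra.Lattice"
begin

section \<open>Matroids\<close>

record 'a matroid =
  ground :: "'a set"
  indep :: "'a set set"

definition is_matroid :: "'a matroid \<Rightarrow> bool" where
  "is_matroid M \<longleftrightarrow>
     finite (ground M) \<and> indep M \<subseteq> Pow (ground M) \<and> {} \<in> indep M \<and>
     (\<forall>Y\<in>indep M. \<forall>X. X \<subseteq> Y \<longrightarrow> X \<in> indep M) \<and>
     (\<forall>X\<in>indep M. \<forall>Y\<in>indep M. card X < card Y \<longrightarrow> (\<exists>y\<in>Y - X. insert y X \<in> indep M))"

definition bases :: "'a matroid \<Rightarrow> 'a set set" where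
  "bases M = {B \<in> indep M. \<forall>X\<in>indep M. B \<subseteq> X \<longrightarrow> X = B}"

definition matroid_rank :: "'a matroid \<Rightarrow> nat" where
  "matroid_rank M = Max (card ` indep M)"

definition deletion :: "'a matroid \<Rightarrow> 'a set \<Rightarrow> 'a matroid" where
  "deletion M X = \<lparr>ground = ground M - X, indep = {Y \<in> indep M. Y \<inter> X = {}}\<rparr>"

definition coloop :: "'a matroid \<Rightarrow> 'a \<Rightarrow> bool" where
  "coloop M e \<longleftrightarrow> e \<in> ground M \<and> (\<forall>B\<in>bases M. e \<in> B)"

definition weak_le :: "'a matroid \<Rightarrow> 'a matroid \<Rightarrow> bool" where
  "weak_le N1 N2 \<longleftrightarrow> indep N1 \<subseteq> indep N2"


section \<open>Transversal matroids\<close>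

text \<open>A set system \<open>(A\<^sub>i : i \<in> [r])\<close> is a function on the naturals of which only the values
  on \<open>{1..r}\<close> matter.\<close>

definition partial_transversal :: "nat \<Rightarrow> (nat \<Rightarrow> 'a set) \<Rightarrow> 'a set \<Rightarrow> bool" where
  "partial_transversal r A X \<longleftrightarrow>
     (\<exists>f. inj_on f X \<and> f ` X \<subseteq> {1..r} \<and> (\<forall>e\<in>X. e \<in> A (f e)))"

definition transversal_matroid :: "'a set \<Rightarrow> nat \<Rightarrow> (nat \<Rightarrow> 'a set) \<Rightarrow> 'a matroid" where
  "transversal_matroid E r A = \<lparr>ground = E, indep = {X. X \<subseteq> E \<and> partial_transversal r A X}\<rparr>"

text \<open>Presentations have exactly as many sets as the rank of the matroid.\<close>

definition presentation :: "(nat \<Rightarrow> 'a set) \<Rightarrow> 'a matroid \<Rightarrow> bool" where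
  "presentation A M \<longleftrightarrow>
     finite (ground M) \<and> (\<forall>i\<in>{1..matroid_rank M}. A i \<subseteq> ground M) \<and>
     M = transversal_matroid (ground M) (matroid_rank M) A"


section \<open>Single-element transversal extensions\<close>

definition extend_system :: "'a \<Rightarrow> (nat \<Rightarrow> 'a set) \<Rightarrow> nat set \<Rightarrow> nat \<Rightarrow> 'a set" where
  "extend_system x A I = (\<lambda>i. if i \<in> I then insert x (A i) else A i)"

definition ext_matroid :: "'a set \<Rightarrow> nat \<Rightarrow> 'a \<Rightarrow> (nat \<Rightarrow> 'a set) \<Rightarrow> nat set \<Rightarrow> 'a matroid" where
  "ext_matroid E r x A I = transversal_matroid (insert x E) r (extend_system x A I)"

definition ext_closure :: "'a set \<Rightarrow> nat \<Rightarrow> 'a \<Rightarrow> (nat \<Rightarrow> 'a set) \<Rightarrow> nat set \<Rightarrow> nat set" where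
  "ext_closure E r x A I =
     I \<union> {k \<in> {1..r} - I. coloop (deletion (ext_matroid E r x A I) (A k)) x}"

definition L_sets :: "'a set \<Rightarrow> nat \<Rightarrow> 'a \<Rightarrow> (nat \<Rightarrow> 'a set) \<Rightarrow> nat set set" where
  "L_sets E r x A = {I. I \<subseteq> {1..r} \<and> ext_closure E r x A I = I}"

definition T_exts :: "'a set \<Rightarrow> nat \<Rightarrow> 'a \<Rightarrow> (nat \<Rightarrow> 'a set) \<Rightarrow> 'a matroid set" where
  "T_exts E r x A = ext_matroid E r x A ` L_sets E r x A"

definition L_common ::
  "'a set \<Rightarrow> nat \<Rightarrow> 'a \<Rightarrow> (nat \<Rightarrow> 'a set) \<Rightarrow> (nat \<Rightarrow> 'a set) \<Rightarrow> nat set set" where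
  "L_common E r x A B =
     {I \<in> L_sets E r x A. \<exists>J\<in>L_sets E r x B. ext_matroid E r x A I = ext_matroid E r x B J}"


section \<open>Sublattices and lattice isomorphism\<close>

definition inclusion_order :: "'b set set \<Rightarrow> 'b set gorder" where
  "inclusion_order S = \<lparr>carrier = S, eq = (=), le = (\<subseteq>)\<rparr>"

definition weak_order :: "'a matroid set \<Rightarrow> 'a matroid gorder" where
  "weak_order S = \<lparr>carrier = S, eq = (=), le = weak_le\<rparr>"

text \<open>The joins and meets are those of the ambient lattice \<open>L\<close>.\<close>

definition sublattice :: "'b set \<Rightarrow> 'b gorder \<Rightarrow> bool" where
  "sublattice S L \<longleftrightarrow>
     lattice L \<and> S \<noteq> {} \<and> S \<subseteq> carrier L \<and>
     (\<forall>a\<in>S. \<forall>b\<in>S. a \<squnion>\<^bsub>L\<^esub> b \<in> S \<and> a \<sqinter>\<^bsub>L\<^esub> b \<in> S)"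

definition lattice_isomorphic :: "'b gorder \<Rightarrow> 'c gorder \<Rightarrow> bool" where
  "lattice_isomorphic L K \<longleftrightarrow>
     (\<exists>h. bij_betw h (carrier L) (carrier K) \<and> join_pres L K h \<and> meet_pres L K h)"


section \<open>Well-definedness\<close>

lemma partial_transversal_augment:
  assumes fin: "finite X" "finite Y" and card: "card X < card Y"
    and f: "inj_on f X" "f ` X \<subseteq> {1..r}" "\<forall>e\<in>X. e \<in> A (f e)"
    and g: "inj_on g Y" "g ` Y \<subseteq> {1..r}" "\<forall>e\<in>Y. e \<in> A (g e)"
  shows "\<exists>y\<in>Y - X. partial_transversal r A (insert y X)"
  using f
proof (induction "card {e \<in> X. f e \<noteq> g e}" arbitrary: f rule: less_induct)
  case less
  have "card (f ` X) < card (g ` Y)"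
    using card less.prems(1) g(1) by (simp add: card_image)
  then have "\<not> g ` Y \<subseteq> f ` X"
    using card_mono[of "f ` X" "g ` Y"] fin by auto
  then obtain y where y: "y \<in> Y" "g y \<notin> f ` X" by blast
  let ?f = "f(y := g y)"
  have inj: "inj_on ?f (insert y X)"
  proof (rule inj_onI)
    fix a b assume "a \<in> insert y X" "b \<in> insert y X" "?f a = ?f b"
    then show "a = b"
      using inj_onD[OF less.prems(1), of a b] y(2)
      by (cases "a = y"; cases "b = y") (simp_all, (metis image_eqI)+)
  qed
  have ran: "?f ` insert y X \<subseteq> {1..r}"
    using less.prems(2) y(1) g(2) by auto
  have mem: "\<forall>e\<in>insert y X. e \<in> A (?f e)"
    using less.prems(3) y(1) g(3) by auto
  show ?case
  proof (cases "y \<in> X")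
    case True
    then have X: "insert y X = X" by auto
    have "{e \<in> X. ?f e \<noteq> g e} \<subset> {e \<in> X. f e \<noteq> g e}"
    proof (rule psubsetI)
      show "{e \<in> X. ?f e \<noteq> g e} \<subseteq> {e \<in> X. f e \<noteq> g e}" by auto
      have "y \<in> {e \<in> X. f e \<noteq> g e}" "y \<notin> {e \<in> X. ?f e \<noteq> g e}"
        using True y(2) by (auto dest: sym)
      then show "{e \<in> X. ?f e \<noteq> g e} \<noteq> {e \<in> X. f e \<noteq> g e}" by blast
    qed
    then have "card {e \<in> X. ?f e \<noteq> g e} < card {e \<in> X. f e \<noteq> g e}"
      using fin(1) by (simp add: psubset_card_mono)
    from less.hyps[OF this] show ?thesis
      using inj ran mem unfolding X by blast
  next
    case False
    then show ?thesis
      using inj ran mem y(1) unfolding partial_transversal_def by blast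
  qed
qed

lemma partial_transversal_subset:
  assumes "partial_transversal r A Y" "X \<subseteq> Y"
  shows "partial_transversal r A X"
proof -
  obtain f where f: "inj_on f Y" "f ` Y \<subseteq> {1..r}" "\<forall>e\<in>Y. e \<in> A (f e)"
    using assms(1) unfolding partial_transversal_def by blast
  have "inj_on f X" using f(1) assms(2) by (rule inj_on_subset)
  moreover have "f ` X \<subseteq> {1..r}" using f(2) assms(2) by blast
  moreover have "\<forall>e\<in>X. e \<in> A (f e)" using f(3) assms(2) by blast
  ultimately show ?thesis unfolding partial_transversal_def by blast
qed

lemma is_matroid_transversal_matroid:
  assumes "finite E"
  shows "is_matroid (transversal_matroid E r A)"
proof -
  have "\<exists>y\<in>Y - X. insert y X \<subseteq> E \<and> partial_transversal r A (insert y X)"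
    if XY: "X \<subseteq> E" "Y \<subseteq> E" "partial_transversal r A X" "partial_transversal r A Y"
      "card X < card Y" for X Y
  proof -
    have fin: "finite X" "finite Y" using XY assms finite_subset by blast+
    obtain f where f: "inj_on f X" "f ` X \<subseteq> {1..r}" "\<forall>e\<in>X. e \<in> A (f e)"
      using XY(3) unfolding partial_transversal_def by blast
    obtain g where g: "inj_on g Y" "g ` Y \<subseteq> {1..r}" "\<forall>e\<in>Y. e \<in> A (g e)"
      using XY(4) unfolding partial_transversal_def by blast
    from partial_transversal_augment[OF fin XY(5) f g] show ?thesis
      using XY(1,2) by blast
  qed
  moreover have "partial_transversal r A {}"
    by (simp add: partial_transversal_def)
  ultimately show ?thesis
    using assms unfolding is_matroid_def transversal_matroid_def
    by (simp add: Collect_mono_iff Pow_def) (blast intro: partial_transversal_subset)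
qed

lemma is_matroid_augment:
  assumes "is_matroid M" "X \<in> indep M" "Y \<in> indep M" "card X < card Y"
  shows "\<exists>y\<in>Y - X. insert y X \<in> indep M"
proof -
  have "\<forall>X\<in>indep M. \<forall>Y\<in>indep M. card X < card Y \<longrightarrow> (\<exists>y\<in>Y - X. insert y X \<in> indep M)"
    using assms(1) unfolding is_matroid_def by (elim conjE)
  from this[rule_format, OF assms(2-4)] show ?thesis .
qed

lemma is_matroid_subset:
  assumes "is_matroid M" "Y \<in> indep M" "X \<subseteq> Y"
  shows "X \<in> indep M"
proof -
  have "\<forall>Y\<in>indep M. \<forall>X. X \<subseteq> Y \<longrightarrow> X \<in> indep M"
    using assms(1) unfolding is_matroid_def by (elim conjE)
  from this[rule_format, OF assms(2,3)] show ?thesis .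
qed

lemma is_matroid_deletion:
  assumes "is_matroid M"
  shows "is_matroid (deletion M Z)"
  unfolding is_matroid_def
proof (intro conjI ballI allI impI)
  have *: "finite (ground M)" "indep M \<subseteq> Pow (ground M)" "{} \<in> indep M"
    using assms unfolding is_matroid_def by - (elim conjE, assumption)+
  show "finite (ground (deletion M Z))" "{} \<in> indep (deletion M Z)"
    using *(1,3) by (simp_all add: deletion_def)
  show "indep (deletion M Z) \<subseteq> Pow (ground (deletion M Z))"
    using *(2) by (auto simp: deletion_def)
next
  fix X Y assume "Y \<in> indep (deletion M Z)" "X \<subseteq> Y"
  then show "X \<in> indep (deletion M Z)"
    using is_matroid_subset[OF assms, of Y X] by (auto simp: deletion_def)
next
  fix X Y assume XY: "X \<in> indep (deletion M Z)" "Y \<in> indep (deletion M Z)" "card X < card Y"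
  then obtain y where "y \<in> Y - X" "insert y X \<in> indep M"
    using is_matroid_augment[OF assms, of X Y] by (auto simp: deletion_def)
  then show "\<exists>y\<in>Y - X. insert y X \<in> indep (deletion M Z)"
    using XY(1,2) by (auto simp: deletion_def)
qed

lemma ext_indep_mono:
  assumes "I \<subseteq> J"
  shows "indep (deletion (ext_matroid E r x A I) Z) \<subseteq> indep (deletion (ext_matroid E r x A J) Z)"
proof -
  have "extend_system x A I i \<subseteq> extend_system x A J i" for i
    using assms by (auto simp: extend_system_def)
  then have "partial_transversal r (extend_system x A J) X"
    if "partial_transversal r (extend_system x A I) X" for X
    using that unfolding partial_transversal_def by (meson subsetD)
  then show ?thesis
    unfolding deletion_def ext_matroid_def transversal_matroid_def by auto
qed

lemma ext_indep_avoiding: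
  assumes "x \<notin> X" "X \<in> indep (deletion (ext_matroid E r x A I) Z)"
  shows "X \<in> indep (deletion (ext_matroid E r x A J) Z)"
proof -
  have "(e \<in> extend_system x A I i) = (e \<in> extend_system x A J i)" if "e \<in> X" for e i
    using that assms(1) by (auto simp: extend_system_def)
  then show ?thesis
    using assms(2) unfolding deletion_def ext_matroid_def transversal_matroid_def
      partial_transversal_def by auto
qed

lemma ext_indep_Un:
  assumes "X \<in> indep (deletion (ext_matroid E r x A (I \<union> J)) Z)"
  shows "X \<in> indep (deletion (ext_matroid E r x A I) Z) \<or>
         X \<in> indep (deletion (ext_matroid E r x A J) Z)"
proof -
  obtain f where f: "inj_on f X" "f ` X \<subseteq> {1..r}" "\<forall>e\<in>X. e \<in> extend_system x A (I \<union> J) (f e)"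
    and X: "X \<subseteq> insert x E" "X \<inter> Z = {}"
    using assms unfolding deletion_def ext_matroid_def transversal_matroid_def
      partial_transversal_def by auto
  have "(\<forall>e\<in>X. e \<in> extend_system x A I (f e)) \<or> (\<forall>e\<in>X. e \<in> extend_system x A J (f e))"
    using f(3) by (auto simp: extend_system_def split: if_splits)
  then show ?thesis
    using f(1,2) X unfolding deletion_def ext_matroid_def transversal_matroid_def
      partial_transversal_def by auto
qed

lemma coloop_ext_mono:
  assumes IJ: "I \<subseteq> J" and c: "coloop (deletion (ext_matroid E r x A I) Z) x"
  shows "coloop (deletion (ext_matroid E r x A J) Z) x"
proof -
  have "x \<in> B" if B: "B \<in> bases (deletion (ext_matroid E r x A J) Z)" for B
  proof (rule ccontr)
    assume "x \<notin> B"
    then have "B \<in> bases (deletion (ext_matroid E r x A I) Z)"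
      using B ext_indep_avoiding[of x B E r A J Z I] ext_indep_mono[OF IJ, of E r x A Z]
      unfolding bases_def by blast
    then show False using c \<open>x \<notin> B\<close> unfolding coloop_def by blast
  qed
  then show ?thesis
    using c by (auto simp: coloop_def deletion_def ext_matroid_def transversal_matroid_def)
qed

lemma coloop_ext_Un:
  assumes "finite E" and c: "coloop (deletion (ext_matroid E r x A (I \<union> J)) Z) x"
  shows "coloop (deletion (ext_matroid E r x A I) Z) x \<or>
         coloop (deletion (ext_matroid E r x A J) Z) x"
proof (rule ccontr)
  let ?D = "\<lambda>K. deletion (ext_matroid E r x A K) Z"
  assume neg: "\<not> ?thesis"
  have gr: "x \<in> ground (?D K)" for K
    using c by (auto simp: coloop_def deletion_def ext_matroid_def transversal_matroid_def)
  obtain B where B: "B \<in> bases (?D I)" "x \<notin> B" using neg gr unfolding coloop_def by blast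
  obtain B' where B': "B' \<in> bases (?D J)" "x \<notin> B'" using neg gr unfolding coloop_def by blast
  have mat: "is_matroid (?D K)" for K
    unfolding ext_matroid_def
    using assms(1) by (intro is_matroid_deletion is_matroid_transversal_matroid) auto
  have aug: "card Y \<le> card C" if CY: "C \<in> bases (?D K)" "Y \<in> indep (?D K)" for C Y K
  proof (rule ccontr)
    assume "\<not> card Y \<le> card C"
    then obtain y where "y \<in> Y - C" "insert y C \<in> indep (?D K)"
      using is_matroid_augment[OF mat, of C K Y] CY unfolding bases_def by auto
    then show False using CY(1) unfolding bases_def by blast
  qed
  have "card B' \<le> card B"
    using aug[OF B(1)] ext_indep_avoiding[OF B'(2), of E r A J Z I] B'(1)
    by (simp add: bases_def)
  have "finite B"
    using B(1) mat[of I] unfolding is_matroid_def bases_def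
    by (metis (no_types, lifting) PowD finite_subset mem_Collect_eq subsetD)
  have "insert x B \<notin> indep (?D J)"
    using aug[OF B'(1), of "insert x B"] \<open>card B' \<le> card B\<close> \<open>finite B\<close> B(2) by auto
  moreover have "insert x B \<notin> indep (?D I)"
    using B unfolding bases_def by blast
  ultimately have x: "insert x B \<notin> indep (?D (I \<union> J))"
    using ext_indep_Un[of "insert x B" E r x A I J Z] by blast
  have "X = B" if "X \<in> indep (?D (I \<union> J))" "B \<subseteq> X" for X
  proof -
    have "x \<notin> X"
      using x that is_matroid_subset[OF mat, of X "I \<union> J" "insert x B"] by blast
    then show ?thesis
      using ext_indep_avoiding[OF _ that(1), of I] that(2) B(1) by (simp add: bases_def)
  qed
  moreover have "B \<in> indep (?D (I \<union> J))"
    using B ext_indep_avoiding[OF B(2), of E r A I Z "I \<union> J"] by (simp add: bases_def)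
  ultimately have "B \<in> bases (?D (I \<union> J))"
    unfolding bases_def by blast
  then show False using c B(2) unfolding coloop_def by blast
qed

lemma L_sets_closed:
  assumes "finite E" "I \<in> L_sets E r x A" "J \<in> L_sets E r x A"
  shows "I \<union> J \<in> L_sets E r x A" "I \<inter> J \<in> L_sets E r x A"
proof -
  have *: "K \<in> L_sets E r x A \<longleftrightarrow> K \<subseteq> {1..r} \<and>
      (\<forall>k\<in>{1..r}. coloop (deletion (ext_matroid E r x A K) (A k)) x \<longrightarrow> k \<in> K)" for K
    unfolding L_sets_def ext_closure_def by blast
  show "I \<union> J \<in> L_sets E r x A"
    using assms(2,3) coloop_ext_Un[OF assms(1), of r x A I J] unfolding * by blast
  show "I \<inter> J \<in> L_sets E r x A"
    using assms(2,3) coloop_ext_mono[of "I \<inter> J" I E r x A] coloop_ext_mono[of "I \<inter> J" J E r x A]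
    unfolding * by blast
qed

lemma least_Upper_L_sets:
  assumes "finite E" "I \<in> L_sets E r x A" "J \<in> L_sets E r x A"
  shows "least (inclusion_order (L_sets E r x A)) K
           (Upper (inclusion_order (L_sets E r x A)) {I, J}) \<longleftrightarrow> K = I \<union> J"
proof -
  have "Upper (inclusion_order (L_sets E r x A)) {I, J} = {K \<in> L_sets E r x A. I \<union> J \<subseteq> K}"
    using assms(2,3) unfolding Upper_def inclusion_order_def by auto
  then show ?thesis
    using L_sets_closed(1)[OF assms] unfolding least_def inclusion_order_def by auto
qed

lemma greatest_Lower_L_sets:
  assumes "finite E" "I \<in> L_sets E r x A" "J \<in> L_sets E r x A"
  shows "greatest (inclusion_order (L_sets E r x A)) K
           (Lower (inclusion_order (L_sets E r x A)) {I, J}) \<longleftrightarrow> K = I \<inter> J"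
proof -
  have "Lower (inclusion_order (L_sets E r x A)) {I, J} = {K \<in> L_sets E r x A. K \<subseteq> I \<inter> J}"
    using assms(2,3) unfolding Lower_def inclusion_order_def by auto
  then show ?thesis
    using L_sets_closed(2)[OF assms] unfolding greatest_def inclusion_order_def by auto
qed

lemma lattice_L_sets:
  assumes "finite E"
  shows "lattice (inclusion_order (L_sets E r x A))"
proof -
  have po: "partial_order (inclusion_order (L_sets E r x A))"
    by unfold_locales (auto simp: inclusion_order_def)
  show ?thesis
    using po least_Upper_L_sets[OF assms] greatest_Lower_L_sets[OF assms]
    by (auto simp: lattice_def upper_semilattice_def lower_semilattice_def
        upper_semilattice_axioms_def lower_semilattice_axioms_def inclusion_order_def)
qed

lemma join_meet_L_sets:
  assumes "finite E" "I \<in> L_sets E r x A" "J \<in> L_sets E r x A"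
  shows "I \<squnion>\<^bsub>inclusion_order (L_sets E r x A)\<^esub> J = I \<union> J"
    and "I \<sqinter>\<^bsub>inclusion_order (L_sets E r x A)\<^esub> J = I \<inter> J"
  using least_Upper_L_sets[OF assms] greatest_Lower_L_sets[OF assms]
  by (simp_all add: join_def meet_def Lattice.sup_def Lattice.inf_def)

end

theory Submission
  imports Defs
begin

text \<open>On \<open>L\<^sub>A\<close> the map \<open>I \<mapsto> M[A\<^sup>I]\<close> is an order embedding into the weak order, and
  \<open>M[A\<^bsup>I \<union> J\<^esup>]\<close> has as independent sets those of \<open>M[A\<^sup>I]\<close> and of \<open>M[A\<^sup>J]\<close>, so joins of common extensions
  are common. For meets, suppose \<open>M[A\<^bsup>I\<^sub>i\<^esup>] = M[B\<^bsup>J\<^sub>i\<^esup>]\<close> for \<open>i = 1, 2\<close>, and let \<open>K \<union> {x}\<close> be a circuit of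
  \<open>M[A\<^bsup>I\<^sub>1 \<inter> I\<^sub>2\<^esup>]\<close>. Write \<open>N\<^sub>A(X)\<close> for the indices whose set meets \<open>X\<close>. A set without coloops has
  exactly as many neighbours in each presentation as its rank. For every circuit \<open>C\<close> of some
  \<open>M[A\<^bsup>I\<^sub>i\<^esup>]\<close> through \<open>x\<close>, the set \<open>C \<union> K\<close> has no coloops in \<open>M[A\<^bsup>I\<^sub>i\<^esup>]\<close>; hence any union of the sets
  \<open>X\<^sub>C = (C - {x}) \<union> K\<close> has equally many neighbours in \<open>A\<close> and in \<open>B\<close>. By inclusion-exclusion the
  intersections of the \<open>N\<^sub>A(X\<^sub>C)\<close> and of the \<open>N\<^sub>B(X\<^sub>C)\<close> have the same size. The first is \<open>N\<^sub>A(K)\<close>, of size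
  \<open>|K|\<close>, because \<open>I\<^sub>i\<close> is closed; the second contains \<open>N\<^sub>B(K) \<union> (J\<^sub>1 \<inter> J\<^sub>2)\<close>, so \<open>K \<union> {x}\<close> is dependent in
  \<open>M[B\<^bsup>J\<^sub>1 \<inter> J\<^sub>2\<^esup>]\<close>.\<close>

section \<open>Hall's theorem and its deficiency version\<close>

definition nbrs :: "nat \<Rightarrow> (nat \<Rightarrow> 'a set) \<Rightarrow> 'a set \<Rightarrow> nat set" where
  "nbrs r A X = {i \<in> {1..r}. A i \<inter> X \<noteq> {}}"

text \<open>Emptying the sets outside \<open>T\<close> keeps the index range \<open>{1..r}\<close>,
  so a matching into \<open>T\<close> is again a partial transversal of a system of \<open>r\<close>
  sets.\<close>

definition on_indices :: "(nat \<Rightarrow> 'a set) \<Rightarrow> nat set \<Rightarrow> nat \<Rightarrow> 'a set" where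
  "on_indices A T = (\<lambda>i. if i \<in> T then A i else {})"

lemma finite_nbrs [simp]: "finite (nbrs r A X)"
  by (simp add: nbrs_def)

lemma nbrs_Un: "nbrs r A (X \<union> Y) = nbrs r A X \<union> nbrs r A Y"
  by (auto simp: nbrs_def)

lemma nbrs_mono: "X \<subseteq> Y \<Longrightarrow> nbrs r A X \<subseteq> nbrs r A Y"
  by (auto simp: nbrs_def)

lemma nbrs_on_indices: "nbrs r (on_indices A T) X = nbrs r A X \<inter> T"
  by (auto simp: nbrs_def on_indices_def)

lemma partial_transversalE:
  assumes "partial_transversal r A X"
  obtains f where "inj_on f X" "f ` X \<subseteq> {1..r}" "\<forall>e\<in>X. e \<in> A (f e)"
  using assms unfolding partial_transversal_def by blast

lemma partial_transversalI:
  assumes "inj_on f X" "f ` X \<subseteq> {1..r}" "\<forall>e\<in>X. e \<in> A (f e)"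
  shows "partial_transversal r A X"
  using assms unfolding partial_transversal_def by blast

lemma matching_nbrs:
  assumes "f ` X \<subseteq> {1..r}" "\<forall>e\<in>X. e \<in> A (f e)"
  shows "f ` X \<subseteq> nbrs r A X"
  using assms by (auto simp: nbrs_def)

lemma partial_transversal_on_indices_iff:
  assumes "nbrs r A X \<subseteq> T"
  shows "partial_transversal r (on_indices A T) X \<longleftrightarrow> partial_transversal r A X"
proof
  assume "partial_transversal r A X"
  then obtain f where f: "inj_on f X" "f ` X \<subseteq> {1..r}" "\<forall>e\<in>X. e \<in> A (f e)"
    by (rule partial_transversalE)
  moreover have "f e \<in> T" if "e \<in> X" for e
    using that matching_nbrs[OF f(2,3)] assms by blast
  ultimately show "partial_transversal r (on_indices A T) X"
    by (intro partial_transversalI[of f]) (auto simp: on_indices_def)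
qed (force simp: on_indices_def partial_transversal_def split: if_splits)

text \<open>The two matchings use disjoint sets of indices, so they combine; on
  \<open>P \<inter> Q\<close> the first one is used.\<close>

lemma partial_transversal_Un:
  assumes P: "partial_transversal r (on_indices A T) P"
    and Q: "partial_transversal r (on_indices A (- T)) Q"
  shows "partial_transversal r A (P \<union> Q)"
proof -
  obtain f where f: "inj_on f P" "f ` P \<subseteq> {1..r}" "\<forall>e\<in>P. e \<in> on_indices A T (f e)"
    using P by (rule partial_transversalE)
  obtain g where g: "inj_on g Q" "g ` Q \<subseteq> {1..r}" "\<forall>e\<in>Q. e \<in> on_indices A (- T) (g e)"
    using Q by (rule partial_transversalE)
  have fT: "f e \<in> T" "e \<in> A (f e)" if "e \<in> P" for e
    using f(3) that by (auto simp: on_indices_def split: if_splits)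
  have gT: "g e \<notin> T" "e \<in> A (g e)" if "e \<in> Q" for e
    using g(3) that by (auto simp: on_indices_def split: if_splits)
  show ?thesis
  proof (rule partial_transversalI[of "\<lambda>e. if e \<in> P then f e else g e"])
    show "inj_on (\<lambda>e. if e \<in> P then f e else g e) (P \<union> Q)"
    proof (rule inj_onI)
      fix a b assume "a \<in> P \<union> Q" "b \<in> P \<union> Q" "(if a \<in> P then f a else g a) = (if b \<in> P then f b else g b)"
      then show "a = b"
        using inj_onD[OF f(1), of a b] inj_onD[OF g(1), of a b] fT(1)[of a] fT(1)[of b] gT(1)[of a] gT(1)[of b]
        by (cases "a \<in> P"; cases "b \<in> P") auto
    qed
  qed (use f(2) g(2) fT gT in auto)
qed

lemma partial_transversal_insert:
  assumes "partial_transversal r (on_indices A (- {k})) Q" "k \<in> {1..r}" "e \<in> A k"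
  shows "partial_transversal r A (insert e Q)"
proof -
  have "partial_transversal r (on_indices A {k}) {e}"
    using assms(2,3) by (intro partial_transversalI[of "\<lambda>_. k"]) (auto simp: on_indices_def)
  from partial_transversal_Un[OF this assms(1)] show ?thesis by simp
qed

lemma partial_transversal_finite:
  assumes "partial_transversal r A X"
  shows "finite X"
  using assms unfolding partial_transversal_def by (meson finite_atLeastAtMost inj_on_finite)

lemma partial_transversal_card_le:
  assumes "partial_transversal r A X"
  shows "card X \<le> card (nbrs r A X)"
proof -
  obtain f where f: "inj_on f X" "f ` X \<subseteq> {1..r}" "\<forall>e\<in>X. e \<in> A (f e)"
    using assms by (rule partial_transversalE)
  with matching_nbrs[OF f(2,3)] show ?thesis by (metis card_image card_mono finite_nbrs)
qed

text \<open>Elements of \<open>Y\<close> in \<open>W\<close> need distinct neighbours of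
  \<open>W\<close>; at most \<open>card (X - W)\<close> others remain. This is the easy half of the
  rank formula; \<open>Hall_deficiency\<close> is the other.\<close>

lemma partial_transversal_card_le_split:
  assumes "partial_transversal r A Y" "Y \<subseteq> X" "finite X"
  shows "card Y \<le> card (nbrs r A W) + card (X - W)"
proof -
  have "card Y = card (Y \<inter> W) + card (Y - W)"
    using card_Int_Diff partial_transversal_finite[OF assms(1)] by blast
  moreover have "card (Y \<inter> W) \<le> card (nbrs r A (Y \<inter> W))"
    using assms(1) by (intro partial_transversal_card_le) (rule partial_transversal_subset, auto)
  moreover have "card (nbrs r A (Y \<inter> W)) \<le> card (nbrs r A W)"
    by (intro card_mono nbrs_mono) auto
  moreover have "card (Y - W) \<le> card (X - W)"
    using assms(2,3) by (intro card_mono) auto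
  ultimately show ?thesis by linarith
qed

text \<open>The Halmos-Vaughan induction: a proper nonempty subset with no surplus of neighbours is
  matched separately from the rest; if every such subset has a surplus, one element may take any of
  its neighbours.\<close>

theorem Hall:
  assumes "finite X" "\<And>W. W \<subseteq> X \<Longrightarrow> card W \<le> card (nbrs r A W)"
  shows "partial_transversal r A X"
  using assms
proof (induction "card X" arbitrary: X A rule: less_induct)
  case less
  note hall = less.prems(2)
  consider (empty) "X = {}"
    | (tight) W where "W \<subset> X" "W \<noteq> {}" "card (nbrs r A W) \<le> card W"
    | (slack) e where "e \<in> X" "\<And>W. W \<subset> X \<Longrightarrow> W \<noteq> {} \<Longrightarrow> card W < card (nbrs r A W)"
    by (meson ex_in_conv not_le)
  then show ?case
  proof cases
    case empty
    then show ?thesis by (simp add: partial_transversal_def)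
  next
    case (tight W)
    have fW: "finite W" using tight(1) less.prems(1) finite_subset by blast
    have "card W < card X" using tight(1) less.prems(1) by (rule psubset_card_mono[rotated])
    then have 1: "partial_transversal r (on_indices A (nbrs r A W)) W"
      using less.hyps[of W A] fW hall tight(1)
      by (simp add: partial_transversal_on_indices_iff)
    have "card (X - W) < card X"
      using tight(1,2) less.prems(1) by (intro psubset_card_mono) auto
    \<comment> \<open>Hall's condition for \<open>V \<union> W\<close>, less the neighbours used up
      by the tight set \<open>W\<close>, is the condition for \<open>V\<close> in the remaining
      system.\<close>
    moreover have "card V \<le> card (nbrs r (on_indices A (- nbrs r A W)) V)" if V: "V \<subseteq> X - W" for V
    proof -
      have fV: "finite V" using V less.prems(1) finite_subset by blast
      have "card V + card W = card (V \<union> W)"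
        using V fV fW by (subst card_Un_disjoint) auto
      also have "\<dots> \<le> card (nbrs r A (V \<union> W))"
        using V tight(1) by (intro hall) auto
      also have "\<dots> = card (nbrs r A V - nbrs r A W) + card (nbrs r A W)"
        by (subst card_Un_disjoint[symmetric]) (auto simp: nbrs_Un)
      finally show ?thesis
        using tight(3) by (simp add: nbrs_on_indices Diff_eq)
    qed
    ultimately have 2: "partial_transversal r (on_indices A (- nbrs r A W)) (X - W)"
      using less.prems(1) by (intro less.hyps) auto
    from partial_transversal_Un[OF 1 2] show ?thesis
      using tight(1) by (simp add: Un_absorb1 psubset_imp_subset)
  next
    case (slack e)
    have "nbrs r A {e} \<noteq> {}" using hall[of "{e}"] slack(1) by auto
    then obtain k where k: "k \<in> {1..r}" "e \<in> A k" by (auto simp: nbrs_def)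
    \<comment> \<open>Losing the index \<open>k\<close> costs \<open>V\<close> at most one
      neighbour, which the strict inequality pays for.\<close>
    have "card V \<le> card (nbrs r (on_indices A (- {k})) V)" if V: "V \<subseteq> X - {e}" for V
    proof (cases "V = {}")
      case False
      then have "card V < card (nbrs r A V)" using V slack by blast
      also have "\<dots> \<le> Suc (card (nbrs r A V - {k}))" by (auto simp: card_Diff_singleton_if)
      finally show ?thesis by (simp add: nbrs_on_indices Diff_eq)
    qed simp
    moreover have "card (X - {e}) < card X"
      using slack(1) less.prems(1) by (meson card_Diff1_less)
    ultimately have "partial_transversal r (on_indices A (- {k})) (X - {e})"
      using less.prems(1) by (intro less.hyps) auto
    from partial_transversal_insert[OF this k] show ?thesis
      using slack(1) by (simp add: insert_absorb)
  qed
qed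

text \<open>The defect \<open>d\<close> is absorbed by \<open>d\<close> additional indices whose sets contain all of \<open>X\<close>.\<close>

lemma Hall_deficiency:
  assumes "finite X"
  obtains W Y where "W \<subseteq> X" "Y \<subseteq> X" "partial_transversal r A Y"
    "card (nbrs r A W) + card (X - W) \<le> card Y"
proof -
  let ?def = "\<lambda>W. int (card W) - int (card (nbrs r A W))"
  have fin: "finite (Pow X)" using assms by simp
  obtain W where W: "W \<subseteq> X" "\<And>V. V \<subseteq> X \<Longrightarrow> ?def V \<le> ?def W"
    using ex_is_arg_min_if_finite[OF fin, of "\<lambda>W. - ?def W"]
    unfolding is_arg_min_linorder by (auto simp: algebra_simps)
  define d where "d = nat (?def W)"
  \<comment> \<open>The empty set has deficiency 0, so the maximum is nonnegative and
    \<open>nat\<close> loses nothing.\<close>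
  have "?def {} \<le> ?def W" by (rule W(2)) simp
  then have d: "int d = ?def W" by (simp add: d_def nbrs_def)
  define A' where "A' = (\<lambda>i. if i \<le> r then A i else X)"
  have "card V \<le> card (nbrs (r + d) A' V)" if V: "V \<subseteq> X" for V
  proof (cases "V = {}")
    case False
    have "nbrs (r + d) A' V = nbrs r A V \<union> {r+1..r+d}"
      using False V by (auto simp: nbrs_def A'_def)
    moreover have "card \<dots> = card (nbrs r A V) + d"
      by (subst card_Un_disjoint) (auto simp: nbrs_def)
    ultimately show ?thesis using W(2)[OF V] d by simp
  qed simp
  then have "partial_transversal (r + d) A' X" by (rule Hall[OF assms])
  then obtain f where f: "inj_on f X" "f ` X \<subseteq> {1..r+d}" "\<forall>e\<in>X. e \<in> A' (f e)"
    by (rule partial_transversalE)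
  define Y where "Y = {e \<in> X. f e \<le> r}"
  have "partial_transversal r A Y"
    using f by (intro partial_transversalI[of f]) (auto simp: Y_def A'_def inj_on_def)
  moreover have "card (nbrs r A W) + card (X - W) \<le> card Y"
  proof -
    have "card (X - Y) \<le> card {r+1..r+d}"
    proof (rule card_inj_on_le)
      show "inj_on f (X - Y)" using f(1) by (rule inj_on_diff)
      show "f ` (X - Y) \<subseteq> {r+1..r+d}" using f(2) by (auto simp: Y_def)
    qed simp
    then have "card (X - Y) \<le> d" by simp
    moreover have "card X = card Y + card (X - Y)" "card X = card W + card (X - W)"
      using assms W(1) card_Int_Diff[of X Y] card_Int_Diff[of X W]
      by (auto simp: Y_def Int_absorb1 Int_absorb2)
    ultimately show ?thesis using d by linarith
  qed
  ultimately show ?thesis using that[OF W(1), of Y] by (auto simp: Y_def)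
qed


section \<open>Sets whose rank is the number of their neighbours\<close>

definition full :: "nat \<Rightarrow> (nat \<Rightarrow> 'a set) \<Rightarrow> 'a set \<Rightarrow> bool" where
  "full r A X \<longleftrightarrow> (\<exists>Y\<subseteq>X. partial_transversal r A Y \<and> card Y = card (nbrs r A X))"

definition circuit :: "nat \<Rightarrow> (nat \<Rightarrow> 'a set) \<Rightarrow> 'a set \<Rightarrow> bool" where
  "circuit r A C \<longleftrightarrow>
     \<not> partial_transversal r A C \<and> (\<forall>e\<in>C. partial_transversal r A (C - {e}))"

text \<open>As \<open>n\<close> is the rank of \<open>X\<close>, which depends only on the matroid, a set without coloops has equally
  many neighbours in all presentations.\<close>

lemma card_nbrs_no_coloops:
  assumes fin: "finite X" and ne: "X \<noteq> {}"
    and nc: "\<And>e. e \<in> X \<Longrightarrow> \<exists>Y\<subseteq>X - {e}. partial_transversal r A Y \<and> card Y = n"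
    and le: "\<And>Y. Y \<subseteq> X \<Longrightarrow> partial_transversal r A Y \<Longrightarrow> card Y \<le> n"
  shows "card (nbrs r A X) = n"
proof -
  obtain W Y where WY: "W \<subseteq> X" "Y \<subseteq> X" "partial_transversal r A Y"
    "card (nbrs r A W) + card (X - W) \<le> card Y"
    using Hall_deficiency[OF fin] by blast
  \<comment> \<open>The bound given by \<open>W\<close> is attained within \<open>X\<close>.
    Removing an \<open>e\<close> outside \<open>W\<close> would lower it, leaving no room for a
    partial transversal of size \<open>n\<close> that avoids \<open>e\<close>.\<close>
  have "W = X"
  proof (rule ccontr)
    assume "W \<noteq> X"
    then obtain e where e: "e \<in> X" "e \<notin> W" using WY(1) by auto
    obtain Z where Z: "Z \<subseteq> X - {e}" "partial_transversal r A Z" "card Z = n"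
      using nc[OF e(1)] by blast
    have "n \<le> card (nbrs r A W) + card (X - {e} - W)"
      using partial_transversal_card_le_split[OF Z(2,1)] fin Z(3) by blast
    also have "X - {e} - W = X - W - {e}" by blast
    also have "card (nbrs r A W) + card \<dots> < card (nbrs r A W) + card (X - W)"
      using e fin by (intro add_strict_left_mono card_Diff1_less) auto
    finally show False using WY(4) le[OF WY(2,3)] by simp
  qed
  then have "card (nbrs r A X) \<le> n" using WY(4) le[OF WY(2,3)] by simp
  moreover obtain Z where Z: "Z \<subseteq> X" "partial_transversal r A Z" "card Z = n"
    using ne nc by blast
  have "n \<le> card (nbrs r A X)"
    using partial_transversal_card_le_split[OF Z(2,1) fin, of X] Z(3) by simp
  ultimately show ?thesis by simp
qed

text \<open>A circuit has rank \<open>card C - 1\<close> and keeps it when any one element is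
  removed, so it has no coloops.\<close>

lemma card_nbrs_circuit:
  assumes "circuit r A C" "finite C"
  shows "card (nbrs r A C) = card C - 1"
proof (rule card_nbrs_no_coloops)
  show "C \<noteq> {}" using assms(1) by (auto simp: circuit_def partial_transversal_def)
  show "\<exists>Y\<subseteq>C - {e}. partial_transversal r A Y \<and> card Y = card C - 1" if "e \<in> C" for e
    using that assms by (intro exI[of _ "C - {e}"]) (auto simp: circuit_def)
  show "card Y \<le> card C - 1" if "Y \<subseteq> C" "partial_transversal r A Y" for Y
  proof -
    have "Y \<subset> C" using that assms(1) by (auto simp: circuit_def)
    then have "card Y < card C" using assms(2) by (rule psubset_card_mono[rotated])
    then show ?thesis by simp
  qed
qed (rule assms(2))

lemma ex_circuit:
  assumes "finite X" "\<not> partial_transversal r A X"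
  obtains C where "C \<subseteq> X" "circuit r A C"
  using assms
proof (induction "card X" arbitrary: X thesis rule: less_induct)
  case less
  show ?case
  proof (cases "circuit r A X")
    case False
    then obtain e where e: "e \<in> X" "\<not> partial_transversal r A (X - {e})"
      using less.prems(3) by (auto simp: circuit_def)
    show ?thesis
    proof (rule less.hyps)
      show "card (X - {e}) < card X" using e(1) less.prems(2) by (meson card_Diff1_less)
    qed (use e less.prems in auto)
  qed (use less.prems in blast)
qed

text \<open>By counting, the matching of \<open>Q\<close> hits all of \<open>S\<close>; the part
  \<open>R\<close> matched outside \<open>T\<close> covers exactly \<open>S - T\<close> and can be
  added to \<open>P\<close>. That members of \<open>R\<close> have a neighbour outside
  \<open>T\<close> later keeps a deleted element out of \<open>R\<close>.\<close>

lemma partial_transversal_extend_matching: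
  assumes P: "partial_transversal r A P" "card P = card T" "nbrs r A P \<subseteq> T"
    and Q: "partial_transversal r A Q" "card Q = card S" "nbrs r A Q \<subseteq> S"
    and fin: "finite S" "finite T"
  obtains R where "R \<subseteq> Q" "\<And>q. q \<in> R \<Longrightarrow> \<not> nbrs r A {q} \<subseteq> T"
    "partial_transversal r A (P \<union> R)" "card (P \<union> R) = card (T \<union> S)"
proof -
  obtain g where g: "inj_on g Q" "g ` Q \<subseteq> {1..r}" "\<forall>e\<in>Q. e \<in> A (g e)"
    using Q(1) by (rule partial_transversalE)
  define R where "R = {q \<in> Q. g q \<notin> T}"
  have "g ` Q \<subseteq> S" using matching_nbrs[OF g(2,3)] Q(3) by blast
  then have gQ: "g ` Q = S"
    using g(1) Q(2) fin(1) by (simp add: card_image card_subset_eq)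
  have RQ: "R \<subseteq> Q" by (auto simp: R_def)
  have nb: "\<not> nbrs r A {q} \<subseteq> T" if "q \<in> R" for q
    using that matching_nbrs[of g "{q}" r A] g(2,3) by (force simp: R_def)
  have "partial_transversal r (on_indices A (- T)) R"
    using g inj_on_subset[OF g(1) RQ]
    by (intro partial_transversalI[of g]) (auto simp: R_def on_indices_def)
  then have pt: "partial_transversal r A (P \<union> R)"
    using P by (intro partial_transversal_Un[of r A T]) (simp_all add: partial_transversal_on_indices_iff)
  have "g ` R = S - T" using gQ by (auto simp: R_def)
  then have "card R = card (S - T)"
    using card_image[OF inj_on_subset[OF g(1) RQ]] by simp
  moreover have "P \<inter> R = {}" using nb P(3) nbrs_mono[of "{_}" P r A] by blast
  ultimately have "card (P \<union> R) = card T + card (S - T)"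
    using P(2) partial_transversal_finite[OF pt] by (subst card_Un_disjoint) auto
  also have "\<dots> = card (T \<union> S)"
    using fin by (subst card_Un_disjoint[symmetric]) (auto simp: Un_Diff_cancel)
  finally show ?thesis using that RQ nb pt by blast
qed

lemma full_Un:
  assumes "full r A X" "full r A X'"
  shows "full r A (X \<union> X')"
proof -
  obtain P where P: "P \<subseteq> X" "partial_transversal r A P" "card P = card (nbrs r A X)"
    using assms(1) unfolding full_def by blast
  obtain Q where Q: "Q \<subseteq> X'" "partial_transversal r A Q" "card Q = card (nbrs r A X')"
    using assms(2) unfolding full_def by blast
  obtain R where "R \<subseteq> Q" "partial_transversal r A (P \<union> R)"
    "card (P \<union> R) = card (nbrs r A X \<union> nbrs r A X')"
    by (rule partial_transversal_extend_matching[OF P(2,3) nbrs_mono[OF P(1)] Q(2,3) nbrs_mono[OF Q(1)]])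
      auto
  then show ?thesis
    using P(1) Q(1) unfolding full_def nbrs_Un by blast
qed

lemma full_UNION:
  assumes "finite P" "P \<noteq> {}" "\<And>p. p \<in> P \<Longrightarrow> full r A (X p)"
  shows "full r A (\<Union>p\<in>P. X p)"
  using assms by (induction P rule: finite_ne_induct) (auto intro: full_Un)

text \<open>A largest partial transversal inside \<open>X\<close> survives in \<open>B\<close> and
  needs as many neighbours there. Used in both directions, this makes the counts equal.\<close>

lemma full_card_nbrs_le:
  assumes "full r A X" "\<And>Y. Y \<subseteq> X \<Longrightarrow> partial_transversal r A Y \<Longrightarrow> partial_transversal r B Y"
  shows "card (nbrs r A X) \<le> card (nbrs r B X)"
proof -
  obtain Y where Y: "Y \<subseteq> X" "partial_transversal r A Y" "card Y = card (nbrs r A X)"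
    using assms(1) unfolding full_def by blast
  have "card Y \<le> card (nbrs r B Y)"
    using assms(2) Y by (intro partial_transversal_card_le) auto
  also have "\<dots> \<le> card (nbrs r B X)" using Y(1) by (intro card_mono nbrs_mono) auto
  finally show ?thesis using Y(3) by simp
qed

text \<open>Inclusion-exclusion determines the size of an intersection from the sizes of all unions;
  the induction step uses \<open>T \<union> (\<Inter>\<^sub>i T\<^sub>i) = \<Inter>\<^sub>i (T \<union> T\<^sub>i)\<close>.\<close>

lemma card_INTER_eq_if_card_UNION_eq:
  fixes T :: "'i \<Rightarrow> 'b set" and V :: "'i \<Rightarrow> 'c set"
  assumes "finite L" "L \<noteq> {}" "\<And>i. i \<in> L \<Longrightarrow> finite (T i)" "\<And>i. i \<in> L \<Longrightarrow> finite (V i)"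
    and "\<And>P. P \<subseteq> L \<Longrightarrow> P \<noteq> {} \<Longrightarrow> card (\<Union>i\<in>P. T i) = card (\<Union>i\<in>P. V i)"
  shows "card (\<Inter>i\<in>L. T i) = card (\<Inter>i\<in>L. V i)"
  using assms
proof (induction L arbitrary: T V rule: finite_ne_induct)
  case (singleton j)
  then show ?case using singleton(3)[of "{j}"] by simp
next
  case (insert j L)
  have 1: "card (\<Inter>i\<in>L. T i) = card (\<Inter>i\<in>L. V i)"
    using insert.prems by (intro insert.IH) auto
  have 2: "card (\<Inter>i\<in>L. T j \<union> T i) = card (\<Inter>i\<in>L. V j \<union> V i)"
  proof (rule insert.IH)
    fix P assume P: "P \<subseteq> L" "P \<noteq> {}"
    have "(\<Union>i\<in>P. T j \<union> T i) = (\<Union>i\<in>insert j P. T i)" "(\<Union>i\<in>P. V j \<union> V i) = (\<Union>i\<in>insert j P. V i)"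
      using P(2) by auto
    then show "card (\<Union>i\<in>P. T j \<union> T i) = card (\<Union>i\<in>P. V j \<union> V i)"
      using insert.prems(3)[of "insert j P"] P(1) by (metis insert_mono insert_not_empty)
  qed (use insert.prems in auto)
  have 3: "card (T j) = card (V j)" using insert.prems(3)[of "{j}"] by simp
  obtain l where l: "l \<in> L" using insert.hyps by blast
  have "finite (T j)" "finite (\<Inter>i\<in>L. T i)" "finite (V j)" "finite (\<Inter>i\<in>L. V i)"
    using insert.prems(1,2) l by (auto intro: finite_INT)
  then have "card (T j) + card (\<Inter>i\<in>L. T i) = card (T j \<union> (\<Inter>i\<in>L. T i)) + card (T j \<inter> (\<Inter>i\<in>L. T i))"
    "card (V j) + card (\<Inter>i\<in>L. V i) = card (V j \<union> (\<Inter>i\<in>L. V i)) + card (V j \<inter> (\<Inter>i\<in>L. V i))"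
    by (simp_all only: card_Un_Int)
  moreover have "card (T j \<union> (\<Inter>i\<in>L. T i)) = card (V j \<union> (\<Inter>i\<in>L. V i))"
    using 2 unfolding Un_INT_distrib .
  ultimately show ?case unfolding INT_insert using 1 3 by linarith
qed


section \<open>Single-element extensions\<close>

lemma nbrs_extend_system:
  assumes "I \<subseteq> {1..r}" "x \<in> X"
  shows "nbrs r (extend_system x A I) X = nbrs r A X \<union> I"
  using assms by (auto simp: nbrs_def extend_system_def)

lemma nbrs_extend_system_avoiding:
  assumes "x \<notin> X"
  shows "nbrs r (extend_system x A I) X = nbrs r A X"
  using assms by (auto simp: nbrs_def extend_system_def)

lemma partial_transversal_extend_avoiding:
  assumes "x \<notin> X"
  shows "partial_transversal r (extend_system x A I) X \<longleftrightarrow> partial_transversal r A X"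
proof -
  have "e \<in> extend_system x A I i \<longleftrightarrow> e \<in> A i" if "e \<in> X" for e i
    using that assms by (auto simp: extend_system_def)
  then show ?thesis unfolding partial_transversal_def by simp
qed

lemma partial_transversal_extend_mono:
  assumes "partial_transversal r (extend_system x A I) X" "I \<subseteq> J"
  shows "partial_transversal r (extend_system x A J) X"
proof -
  have "extend_system x A I i \<subseteq> extend_system x A J i" for i
    using assms(2) by (auto simp: extend_system_def)
  then show ?thesis using assms(1) unfolding partial_transversal_def by (meson subsetD)
qed

lemma indep_ext_matroid:
  "X \<in> indep (ext_matroid E r x A I) \<longleftrightarrow>
     X \<subseteq> insert x E \<and> partial_transversal r (extend_system x A I) X"
  by (simp add: ext_matroid_def transversal_matroid_def)

lemma ext_matroid_eqD:
  assumes "ext_matroid E r x A I = ext_matroid E r x B J" "X \<subseteq> insert x E"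
  shows "partial_transversal r (extend_system x A I) X \<longleftrightarrow>
    partial_transversal r (extend_system x B J) X"
  using assms indep_ext_matroid by metis

lemma ext_matroid_eqI:
  assumes "indep (ext_matroid E r x A I) = indep (ext_matroid E r x B J)"
  shows "ext_matroid E r x A I = ext_matroid E r x B J"
  using assms by (simp add: ext_matroid_def transversal_matroid_def)

text \<open>A matching gives \<open>x\<close> a single index, which lies in \<open>I\<close> or in
  \<open>J\<close>; the other elements are unaffected.\<close>

lemma indep_ext_matroid_Un:
  "indep (ext_matroid E r x A (I \<union> J)) =
     indep (ext_matroid E r x A I) \<union> indep (ext_matroid E r x A J)"
proof -
  have "deletion (ext_matroid E r x A K) {} = ext_matroid E r x A K" for K
    by (simp add: deletion_def ext_matroid_def transversal_matroid_def)
  then show ?thesis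
    using ext_indep_Un[of _ E r x A I J "{}"] ext_indep_mono[of I "I \<union> J" E r x A "{}"]
      ext_indep_mono[of J "I \<union> J" E r x A "{}"] by auto
qed

text \<open>The independent set \<open>C - {x}\<close> already has at least
  \<open>card C - 1\<close> neighbours, and the circuit \<open>C\<close> has no more. So
  \<open>x\<close> adds none, and its indices \<open>I\<close> are among those of
  \<open>C - {x}\<close>.\<close>

lemma circuit_extend_system:
  assumes C: "circuit r (extend_system x A I) C" "finite C" "x \<in> C" and I: "I \<subseteq> {1..r}"
  shows "partial_transversal r A (C - {x})"
    and "card (nbrs r A (C - {x})) = card (C - {x})"
    and "nbrs r (extend_system x A I) C = nbrs r A (C - {x})"
    and "I \<subseteq> nbrs r A (C - {x})"
proof -
  have "partial_transversal r (extend_system x A I) (C - {x})"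
    using C by (simp add: circuit_def)
  then show pt: "partial_transversal r A (C - {x})"
    by (simp add: partial_transversal_extend_avoiding)
  have le: "card (C - {x}) \<le> card (nbrs r A (C - {x}))"
    using pt by (rule partial_transversal_card_le)
  have sub: "nbrs r A (C - {x}) \<union> I \<subseteq> nbrs r (extend_system x A I) C"
    using I C(3) nbrs_mono[of "C - {x}" C r A] by (auto simp: nbrs_extend_system)
  have card: "card (nbrs r (extend_system x A I) C) = card (C - {x})"
    using card_nbrs_circuit[OF C(1,2)] C(2,3) by simp
  show eq: "nbrs r (extend_system x A I) C = nbrs r A (C - {x})"
    using sub card le by (intro card_seteq[symmetric]) auto
  show "card (nbrs r A (C - {x})) = card (C - {x})" using eq card by simp
  show "I \<subseteq> nbrs r A (C - {x})" using sub eq by blast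
qed

text \<open>Since \<open>I\<close> is closed and misses \<open>k\<close>, the deletion of
  \<open>A k\<close> has a basis avoiding \<open>x\<close>. It serves as \<open>X\<close>;
  maximality makes \<open>insert x X\<close> dependent.\<close>

lemma not_coloop_L_sets:
  assumes E: "x \<notin> E" "\<And>i. i \<in> {1..r} \<Longrightarrow> A i \<subseteq> E"
    and I: "I \<in> L_sets E r x A" and k: "k \<in> {1..r}" "k \<notin> I"
  obtains X where "X \<subseteq> E" "X \<inter> A k = {}" "partial_transversal r A X"
    "\<not> partial_transversal r (extend_system x A I) (insert x X)"
proof -
  let ?D = "deletion (ext_matroid E r x A I) (A k)"
  have xk: "x \<notin> A k" using E k(1) by blast
  then have "x \<in> ground ?D"
    by (simp add: deletion_def ext_matroid_def transversal_matroid_def)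
  moreover have "\<not> coloop ?D x" using I k unfolding L_sets_def ext_closure_def by blast
  ultimately obtain X where X: "X \<in> bases ?D" "x \<notin> X" unfolding coloop_def by blast
  have *: "Y \<in> indep ?D \<longleftrightarrow> Y \<subseteq> insert x E \<and> Y \<inter> A k = {} \<and>
      partial_transversal r (extend_system x A I) Y" for Y
    unfolding deletion_def using indep_ext_matroid[of Y E r x A I] by auto
  have XD: "X \<in> indep ?D" and "insert x X \<notin> indep ?D"
    using X unfolding bases_def by blast+
  then have "\<not> partial_transversal r (extend_system x A I) (insert x X)"
    unfolding * using xk by blast
  moreover have "X \<subseteq> E" "X \<inter> A k = {}" using XD X(2) unfolding * by auto
  moreover have "partial_transversal r A X"
    using XD X(2) unfolding * by (simp add: partial_transversal_extend_avoiding)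
  ultimately show ?thesis using that by blast
qed

text \<open>For \<open>k\<close> in \<open>I - J\<close>, the set \<open>X\<close> from
  \<open>not_coloop_L_sets\<close> avoids \<open>A k\<close>, so the index \<open>k\<close> is free
  for \<open>x\<close>: \<open>insert x X\<close> is independent for \<open>I\<close> but not for
  \<open>J\<close>.\<close>

lemma weak_le_ext_matroid_iff:
  assumes E: "x \<notin> E" "\<And>i. i \<in> {1..r} \<Longrightarrow> A i \<subseteq> E"
    and I: "I \<subseteq> {1..r}" and J: "J \<in> L_sets E r x A"
  shows "weak_le (ext_matroid E r x A I) (ext_matroid E r x A J) \<longleftrightarrow> I \<subseteq> J"
proof
  assume le: "weak_le (ext_matroid E r x A I) (ext_matroid E r x A J)"
  show "I \<subseteq> J"
  proof (rule ccontr)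
    assume "\<not> I \<subseteq> J"
    then obtain k where k: "k \<in> I" "k \<notin> J" "k \<in> {1..r}" using I by blast
    obtain X where X: "X \<subseteq> E" "X \<inter> A k = {}" "partial_transversal r A X"
      "\<not> partial_transversal r (extend_system x A J) (insert x X)"
      using not_coloop_L_sets[OF E J k(3,2)] by blast
    have "x \<notin> X" using X(1) E(1) by blast
    have "partial_transversal r (on_indices (extend_system x A I) (- {k})) X"
    proof (subst partial_transversal_on_indices_iff)
      show "nbrs r (extend_system x A I) X \<subseteq> - {k}"
        using X(2) \<open>x \<notin> X\<close> by (auto simp: nbrs_extend_system_avoiding) (auto simp: nbrs_def)
    qed (use X(3) \<open>x \<notin> X\<close> in \<open>simp add: partial_transversal_extend_avoiding\<close>)
    then have "partial_transversal r (extend_system x A I) (insert x X)"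
      using k(1,3) by (intro partial_transversal_insert) (auto simp: extend_system_def)
    then have "insert x X \<in> indep (ext_matroid E r x A I)"
      using X(1) by (auto simp: indep_ext_matroid)
    then have "insert x X \<in> indep (ext_matroid E r x A J)" using le by (auto simp: weak_le_def)
    then show False using X(4) by (simp add: indep_ext_matroid)
  qed
next
  assume "I \<subseteq> J"
  then show "weak_le (ext_matroid E r x A I) (ext_matroid E r x A J)"
    by (auto simp: weak_le_def indep_ext_matroid intro: partial_transversal_extend_mono)
qed

text \<open>Every index outside a closed \<open>I\<close> is missed by some circuit through
  \<open>x\<close>. These circuits cut the intersection of the neighbour sets down to
  \<open>I\<close>.\<close>

lemma L_sets_circuit:
  assumes E: "x \<notin> E" "\<And>i. i \<in> {1..r} \<Longrightarrow> A i \<subseteq> E" "finite E"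
    and I: "I \<in> L_sets E r x A" and k: "k \<in> {1..r}" "k \<notin> I"
  obtains C where "C \<subseteq> insert x E" "x \<in> C" "circuit r (extend_system x A I) C"
    "k \<notin> nbrs r A (C - {x})"
proof -
  obtain X where X: "X \<subseteq> E" "X \<inter> A k = {}" "partial_transversal r A X"
    "\<not> partial_transversal r (extend_system x A I) (insert x X)"
    using not_coloop_L_sets[OF E(1,2) I k] by blast
  have "finite (insert x X)" using X(1) E(3) finite_subset by blast
  then obtain C where C: "C \<subseteq> insert x X" "circuit r (extend_system x A I) C"
    using ex_circuit X(4) by blast
  have "x \<in> C"
  proof (rule ccontr)
    assume "x \<notin> C"
    then have "partial_transversal r A C" using C(1) X(3) by (blast intro: partial_transversal_subset)
    then show False
      using C(2) \<open>x \<notin> C\<close> by (simp add: circuit_def partial_transversal_extend_avoiding)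
  qed
  moreover have "k \<notin> nbrs r A (C - {x})" using C(1) X(2) by (auto simp: nbrs_def)
  ultimately show ?thesis using that C X(1) by blast
qed


section \<open>Meets of common extensions\<close>

text \<open>In the common extension \<open>insert x X\<close> has rank
  \<open>card (T \<union> S)\<close> and no coloops: for \<open>e\<close> in \<open>C\<close>,
  extend \<open>C - {e}\<close> by elements of \<open>K\<close>; otherwise extend
  \<open>C - {x}\<close> by elements of \<open>insert x K - {e}\<close>. So the number of neighbours
  is the same in both systems.\<close>

lemma full_circuit_Un:
  assumes E: "finite E" "x \<notin> E"
    and M: "\<And>X. X \<subseteq> E \<Longrightarrow> partial_transversal r A X \<longleftrightarrow> partial_transversal r B X"
    and I: "I \<subseteq> I'" "I' \<subseteq> {1..r}" and J: "J \<subseteq> {1..r}"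
    and eq: "ext_matroid E r x A I' = ext_matroid E r x B J"
    and C: "circuit r (extend_system x A I') C" "x \<in> C" "C \<subseteq> insert x E"
    and K: "circuit r (extend_system x A I) (insert x K)" "K \<subseteq> E"
  defines "X \<equiv> (C - {x}) \<union> K"
  shows "full r A X" "full r B X" "J \<subseteq> nbrs r B X"
proof -
  have fin: "finite C" "finite K" using C(3) K(2) E(1) finite_subset by blast+
  have xK: "x \<notin> K" using K(2) E(2) by blast
  define T where "T = nbrs r A (C - {x})"
  define S where "S = nbrs r A K"
  let ?n = "card (T \<union> S)"
  note c = circuit_extend_system[OF C(1) fin(1) C(2) I(2), folded T_def]
  have "finite (insert x K)" "x \<in> insert x K" "I \<subseteq> {1..r}" using fin I by auto
  from circuit_extend_system[OF K(1) this] xK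
  have k: "partial_transversal r A K" "card S = card K"
    "nbrs r (extend_system x A I) (insert x K) = S" "I \<subseteq> S"
    by (simp_all add: S_def)
  have finTS: "finite T" "finite S" by (simp_all add: T_def S_def)
  have nX: "nbrs r A X = T \<union> S" by (simp add: X_def nbrs_Un T_def S_def)
  have CK: "C \<union> K = insert x X" using C(2) by (auto simp: X_def)
  have xX: "x \<notin> X" using xK by (simp add: X_def)
  have XE: "X \<subseteq> E" using C(3) K(2) by (auto simp: X_def)
  have nC: "nbrs r (extend_system x A I') (insert x X) = T \<union> S"
    unfolding CK[symmetric] using c(3) xK by (simp add: nbrs_Un nbrs_extend_system_avoiding S_def)
  have nc: "\<exists>Y\<subseteq>insert x X - {e}. partial_transversal r (extend_system x A I') Y \<and> card Y = ?n"
    if e: "e \<in> insert x X" for e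
  proof (cases "e \<in> C")
    case True
    have 1: "partial_transversal r (extend_system x A I') (C - {e})"
      using C(1) True by (simp add: circuit_def)
    have 2: "card (C - {e}) = card T" using True C(2) fin(1) c(2) by simp
    have 3: "nbrs r (extend_system x A I') (C - {e}) \<subseteq> T"
      using nbrs_mono[of "C - {e}" C] c(3) by blast
    have 4: "partial_transversal r (extend_system x A I') K"
      using k(1) xK by (simp add: partial_transversal_extend_avoiding)
    have 5: "nbrs r (extend_system x A I') K \<subseteq> S"
      using xK by (simp add: nbrs_extend_system_avoiding S_def)
    obtain R where R: "R \<subseteq> K" "\<And>q. q \<in> R \<Longrightarrow> \<not> nbrs r (extend_system x A I') {q} \<subseteq> T"
      "partial_transversal r (extend_system x A I') (C - {e} \<union> R)" "card (C - {e} \<union> R) = ?n"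
      using partial_transversal_extend_matching[OF 1 2 3 4 k(2)[symmetric] 5 finTS(2,1)] by blast
    \<comment> \<open>All neighbours of \<open>e\<close> lie in \<open>T\<close>, as
      \<open>e\<close> belongs to \<open>C\<close>.\<close>
    have "e \<notin> R" using R(2)[of e] nbrs_mono[of "{e}" C] True c(3) by blast
    then have "C - {e} \<union> R \<subseteq> insert x X - {e}" using R(1) CK by blast
    then show ?thesis using R(3,4) by blast
  next
    case False
    then have e: "e \<in> K" "e \<noteq> x" using e CK C(2) by auto
    \<comment> \<open>The system extended by \<open>I\<close> is used because there the neighbours
      of \<open>insert x K\<close> stay within \<open>S\<close>; monotonicity then passes to
      \<open>I'\<close>.\<close>
    let ?Q = "insert x K - {e}"
    have 1: "partial_transversal r (extend_system x A I) (C - {x})"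
      using c(1) by (simp add: partial_transversal_extend_avoiding)
    have 3: "nbrs r (extend_system x A I) (C - {x}) \<subseteq> T"
      by (simp add: nbrs_extend_system_avoiding T_def)
    have 4: "partial_transversal r (extend_system x A I) ?Q"
      using K(1) e by (simp add: circuit_def)
    have 5: "card ?Q = card S" using e xK k(2) fin(2) by (simp add: card_gt_0_iff)
    have 6: "nbrs r (extend_system x A I) ?Q \<subseteq> S"
      using nbrs_mono[of ?Q "insert x K"] k(3) by blast
    obtain R where R: "R \<subseteq> ?Q" "\<And>q. q \<in> R \<Longrightarrow> \<not> nbrs r (extend_system x A I) {q} \<subseteq> T"
      "partial_transversal r (extend_system x A I) (C - {x} \<union> R)" "card (C - {x} \<union> R) = ?n"
      using partial_transversal_extend_matching[OF 1 c(2)[symmetric] 3 4 5 6 finTS(2,1)] by blast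
    have "C - {x} \<union> R \<subseteq> insert x X - {e}" using R(1) CK False by blast
    moreover have "partial_transversal r (extend_system x A I') (C - {x} \<union> R)"
      using R(3) I(1) by (rule partial_transversal_extend_mono)
    ultimately show ?thesis using R(4) by blast
  qed
  \<comment> \<open>With \<open>x\<close> removed, \<open>Y\<close> is independent in the matroid
    being extended and so carries over to \<open>B\<close>.\<close>
  obtain Y where Y: "Y \<subseteq> X" "partial_transversal r A Y" "card Y = ?n"
  proof -
    obtain Y where Y: "Y \<subseteq> insert x X - {x}" "partial_transversal r (extend_system x A I') Y" "card Y = ?n"
      using nc[of x] by blast
    have "Y \<subseteq> X" "x \<notin> Y" using Y(1) by auto
    then show ?thesis using that Y(2,3) by (simp add: partial_transversal_extend_avoiding)
  qed
  then show "full r A X" unfolding full_def nX by blast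
  have sub: "insert x X \<subseteq> insert x E" using XE by blast
  have fX: "finite (insert x X)" using finite_subset[OF sub] E(1) by simp
  have cB: "card (nbrs r (extend_system x B J) (insert x X)) = ?n"
  proof (rule card_nbrs_no_coloops[OF fX])
    show "\<exists>Y\<subseteq>insert x X - {e}. partial_transversal r (extend_system x B J) Y \<and> card Y = ?n"
      if e: "e \<in> insert x X" for e
    proof -
      obtain Y where Y: "Y \<subseteq> insert x X - {e}" "partial_transversal r (extend_system x A I') Y" "card Y = ?n"
        using nc[OF e] by blast
      have "Y \<subseteq> insert x E" using Y(1) sub by blast
      then show ?thesis using Y ext_matroid_eqD[OF eq, of Y] by blast
    qed
    show "card Y \<le> ?n" if Y: "Y \<subseteq> insert x X" "partial_transversal r (extend_system x B J) Y" for Y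
    proof -
      have "partial_transversal r (extend_system x A I') Y"
        using ext_matroid_eqD[OF eq, of Y] Y sub by blast
      from partial_transversal_card_le_split[OF this Y(1) fX, of "insert x X"]
      show ?thesis by (simp add: nC)
    qed
  qed simp
  have pB: "partial_transversal r B Y" using Y M XE by blast
  \<comment> \<open>A squeeze: \<open>X\<close> alone has at least \<open>?n\<close> neighbours in
    \<open>B\<close>, and \<open>insert x X\<close> has exactly \<open>?n\<close>, so
    \<open>J\<close> adds nothing.\<close>
  have "?n \<le> card (nbrs r B X)"
    using partial_transversal_card_le_split[OF pB Y(1), of X] fX Y(3) by simp
  moreover have sub': "nbrs r B X \<union> J \<subseteq> nbrs r (extend_system x B J) (insert x X)"
    using J nbrs_mono[of X "insert x X" r B] by (auto simp: nbrs_extend_system)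
  ultimately have nB: "nbrs r B X = nbrs r (extend_system x B J) (insert x X)"
    using cB by (intro card_seteq) auto
  then show "J \<subseteq> nbrs r B X" using sub' by blast
  have "card Y = card (nbrs r B X)" using Y(3) nB cB by simp
  then show "full r B X" using Y(1) pB unfolding full_def by blast
qed

text \<open>A set independent only on the \<open>B\<close> side contains a circuit
  \<open>C = insert x K\<close> of the \<open>A\<close> side. It needs \<open>card C\<close>
  neighbours on the \<open>B\<close> side, but inclusion-exclusion allows only
  \<open>card K\<close>.\<close>

lemma indep_ext_matroid_Int_le:
  assumes E: "finite E" "x \<notin> E" "\<And>i. i \<in> {1..r} \<Longrightarrow> A i \<subseteq> E" "\<And>i. i \<in> {1..r} \<Longrightarrow> B i \<subseteq> E"
    and M: "\<And>X. X \<subseteq> E \<Longrightarrow> partial_transversal r A X \<longleftrightarrow> partial_transversal r B X"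
    and I: "I1 \<in> L_sets E r x A" "I2 \<in> L_sets E r x A" and J: "J1 \<subseteq> {1..r}" "J2 \<subseteq> {1..r}"
    and eq: "ext_matroid E r x A I1 = ext_matroid E r x B J1"
      "ext_matroid E r x A I2 = ext_matroid E r x B J2"
  shows "indep (ext_matroid E r x B (J1 \<inter> J2)) \<subseteq> indep (ext_matroid E r x A (I1 \<inter> I2))"
proof (rule subsetI, rule ccontr)
  fix Y assume "Y \<in> indep (ext_matroid E r x B (J1 \<inter> J2))"
    and "Y \<notin> indep (ext_matroid E r x A (I1 \<inter> I2))"
  then have Y: "Y \<subseteq> insert x E" "partial_transversal r (extend_system x B (J1 \<inter> J2)) Y"
    "\<not> partial_transversal r (extend_system x A (I1 \<inter> I2)) Y"
    by (auto simp: indep_ext_matroid)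
  have Ir: "I1 \<subseteq> {1..r}" "I2 \<subseteq> {1..r}" using I by (auto simp: L_sets_def)
  have "finite Y" using Y(1) E(1) finite_subset by blast
  then obtain C where C: "C \<subseteq> Y" "circuit r (extend_system x A (I1 \<inter> I2)) C"
    using ex_circuit Y(3) by blast
  have pC: "partial_transversal r (extend_system x B (J1 \<inter> J2)) C"
    using Y(2) C(1) by (rule partial_transversal_subset)
  have xC: "x \<in> C"
  proof (rule ccontr)
    assume x: "x \<notin> C"
    then have "C \<subseteq> E" using C(1) Y(1) by blast
    then have "partial_transversal r A C"
      using pC x M by (simp add: partial_transversal_extend_avoiding)
    then show False using C(2) x by (simp add: circuit_def partial_transversal_extend_avoiding)
  qed
  define K where "K = C - {x}"
  have CK: "C = insert x K" and xK: "x \<notin> K" and KE: "K \<subseteq> E"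
    using xC C(1) Y(1) by (auto simp: K_def)
  have fC: "finite C" using C(1) \<open>finite Y\<close> finite_subset by blast
  define S where "S = nbrs r A K"
  have S: "card S = card K" "I1 \<inter> I2 \<subseteq> S" "S \<subseteq> {1..r}"
    using circuit_extend_system(2,4)[OF C(2) fC xC] Ir by (auto simp: S_def K_def nbrs_def)
  have JK: "nbrs r (extend_system x B (J1 \<inter> J2)) C = nbrs r B C \<union> (J1 \<inter> J2)"
    using J xC by (intro nbrs_extend_system) auto
  have nbrs_B: "nbrs r B C = nbrs r B K" using E(2,4) by (auto simp: nbrs_def CK)
  \<comment> \<open>By \<open>circuit_extend_system\<close>, an index of \<open>I1\<close> is missed
    by no circuit through \<open>x\<close> of the first extension, and likewise for
    \<open>I2\<close>; hence circuits of both are collected.\<close>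
  define L where "L = {D. D \<subseteq> insert x E \<and> x \<in> D \<and>
    (circuit r (extend_system x A I1) D \<or> circuit r (extend_system x A I2) D)}"
  define X where "X = (\<lambda>D. (D - {x}) \<union> K)"
  have "finite L" using E(1) by (rule_tac finite_subset[of _ "Pow (insert x E)"]) (auto simp: L_def)
  have XE: "X D \<subseteq> E" if "D \<in> L" for D using that KE by (auto simp: X_def L_def)
  have full: "full r A (X D) \<and> full r B (X D) \<and> J1 \<inter> J2 \<subseteq> nbrs r B (X D)" if D: "D \<in> L" for D
  proof -
    have Dx: "x \<in> D" "D \<subseteq> insert x E" using D by (auto simp: L_def)
    note * = full_circuit_Un[OF E(1,2) M, where C = D and K = K and I = "I1 \<inter> I2"]
    from D have "circuit r (extend_system x A I1) D \<or> circuit r (extend_system x A I2) D"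
      by (simp add: L_def)
    then show ?thesis
    proof
      assume "circuit r (extend_system x A I1) D"
      then show ?thesis
        using *[of I1 J1] Ir(1) J(1) eq(1) Dx C(2) CK KE unfolding X_def by blast
    next
      assume "circuit r (extend_system x A I2) D"
      then show ?thesis
        using *[of I2 J2] Ir(2) J(2) eq(2) Dx C(2) CK KE unfolding X_def by blast
    qed
  qed
  have avoid: "\<exists>D\<in>L. k \<notin> nbrs r A (D - {x})" if k: "k \<in> {1..r}" "k \<notin> I1 \<inter> I2" for k
  proof (cases "k \<in> I1")
    case False
    show ?thesis
      by (rule L_sets_circuit[OF E(2,3,1) I(1) k(1) False]) (auto simp: L_def)
  next
    case True
    then have "k \<notin> I2" using k(2) by blast
    show ?thesis
      by (rule L_sets_circuit[OF E(2,3,1) I(2) k(1) \<open>k \<notin> I2\<close>]) (auto simp: L_def)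
  qed
  have "card (nbrs r (extend_system x B (J1 \<inter> J2)) C) \<le> card S"
  \<comment> \<open>Without circuits through \<open>x\<close>, every index lies in
    \<open>I1 \<inter> I2\<close> and so in \<open>S\<close>. The case is separate because the
    intersection over an empty family is \<open>UNIV\<close>.\<close>
  proof (cases "L = {}")
    case True
    have "{1..r} \<subseteq> I1 \<inter> I2"
    proof (rule subsetI, rule ccontr)
      fix k assume "k \<in> {1..r}" "k \<notin> I1 \<inter> I2"
      then have "\<exists>D. D \<in> L" using avoid by blast
      then show False using True by blast
    qed
    then have "nbrs r (extend_system x B (J1 \<inter> J2)) C \<subseteq> S" using S(2) unfolding nbrs_def by blast
    then show ?thesis by (intro card_mono) (simp_all add: S_def)
  next
    case False
    have "card (\<Inter>D\<in>L. nbrs r A (X D)) = card (\<Inter>D\<in>L. nbrs r B (X D))"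
    proof (rule card_INTER_eq_if_card_UNION_eq[OF \<open>finite L\<close> False])
      fix P assume P: "P \<subseteq> L" "P \<noteq> {}"
      let ?X = "\<Union>D\<in>P. X D"
      have "finite P" using P(1) \<open>finite L\<close> finite_subset by blast
      then have "full r A ?X" "full r B ?X" using P full by (auto intro!: full_UNION)
      moreover have "?X \<subseteq> E" using P(1) XE by blast
      ultimately have "card (nbrs r A ?X) = card (nbrs r B ?X)"
        using M full_card_nbrs_le[of r A ?X B] full_card_nbrs_le[of r B ?X A]
        by (meson antisym subset_trans)
      moreover have "nbrs r F ?X = (\<Union>D\<in>P. nbrs r F (X D))" for F by (auto simp: nbrs_def)
      ultimately show "card (\<Union>D\<in>P. nbrs r A (X D)) = card (\<Union>D\<in>P. nbrs r B (X D))" by simp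
    qed auto
    moreover have "(\<Inter>D\<in>L. nbrs r A (X D)) \<subseteq> S"
    proof (rule subsetI, rule ccontr)
      fix k assume k: "k \<in> (\<Inter>D\<in>L. nbrs r A (X D))" "k \<notin> S"
      have "k \<in> {1..r}" using k(1) False by (auto simp: nbrs_def)
      moreover have "k \<notin> I1 \<inter> I2" using S(2) k(2) by blast
      ultimately have "\<exists>D\<in>L. k \<notin> nbrs r A (D - {x})" by (rule avoid)
      then show False using k by (auto simp: X_def nbrs_Un S_def)
    qed
    then have "card (\<Inter>D\<in>L. nbrs r A (X D)) \<le> card S" by (intro card_mono) (simp_all add: S_def)
    \<comment> \<open>Each set in the intersection contains the neighbours of \<open>K\<close>, and
      contains \<open>J1\<close> or \<open>J2\<close>, hence \<open>J1 \<inter> J2\<close>.\<close>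
    moreover have "nbrs r (extend_system x B (J1 \<inter> J2)) C \<subseteq> (\<Inter>D\<in>L. nbrs r B (X D))"
    proof -
      have "nbrs r (extend_system x B (J1 \<inter> J2)) C = nbrs r B K \<union> (J1 \<inter> J2)"
        using JK nbrs_B by simp
      then show ?thesis using full nbrs_mono[of K "X _" r B] by (auto simp: X_def nbrs_Un)
    qed
    moreover have "finite (\<Inter>D\<in>L. nbrs r B (X D))" using False by (meson ex_in_conv finite_INT finite_nbrs)
    ultimately show ?thesis
      using card_mono[of "\<Inter>D\<in>L. nbrs r B (X D)" "nbrs r (extend_system x B (J1 \<inter> J2)) C"]
      by linarith
  qed
  moreover have "card C \<le> card (nbrs r (extend_system x B (J1 \<inter> J2)) C)"
    using pC by (rule partial_transversal_card_le)
  ultimately show False using S(1) CK xK fC by simp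
qed


section \<open>The lattices of extensions\<close>

text \<open>An order embedding carries unions and intersections to joins and meets. It is applied to
  \<open>ext_matroid\<close> and to the identity.\<close>

lemma lattice_image_of_set_lattice:
  fixes G :: "'b gorder" and L :: "'c set set"
  assumes G: "carrier G = f ` L" "eq G = (=)"
    and L: "\<And>I J. I \<in> L \<Longrightarrow> J \<in> L \<Longrightarrow> I \<union> J \<in> L \<and> I \<inter> J \<in> L"
    and le: "\<And>I J. I \<in> L \<Longrightarrow> J \<in> L \<Longrightarrow> le G (f I) (f J) \<longleftrightarrow> I \<subseteq> J"
  shows "lattice G"
    and "I \<in> L \<Longrightarrow> J \<in> L \<Longrightarrow> f I \<squnion>\<^bsub>G\<^esub> f J = f (I \<union> J)"
    and "I \<in> L \<Longrightarrow> J \<in> L \<Longrightarrow> f I \<sqinter>\<^bsub>G\<^esub> f J = f (I \<inter> J)"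
proof -
  have po: "partial_order G"
    by unfold_locales (use G le in \<open>auto dest: equalityI\<close>)
  then interpret partial_order G .
  have lub: "least G (f (I \<union> J)) (Upper G {f I, f J})" if "I \<in> L" "J \<in> L" for I J
    unfolding least_def Upper_def using that L[OF that] by (auto simp: G le)
  have glb: "greatest G (f (I \<inter> J)) (Lower G {f I, f J})" if "I \<in> L" "J \<in> L" for I J
    unfolding greatest_def Lower_def using that L[OF that] by (auto simp: G le)
  show "lattice G"
  proof unfold_locales
    fix a b assume "a \<in> carrier G" "b \<in> carrier G"
    then obtain I J where "I \<in> L" "J \<in> L" "a = f I" "b = f J" unfolding G by blast
    then show "\<exists>s. least G s (Upper G {a, b})" "\<exists>s. greatest G s (Lower G {a, b})"
      using lub glb by blast+
  qed
  show "f I \<squnion>\<^bsub>G\<^esub> f J = f (I \<union> J)" if "I \<in> L" "J \<in> L"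
    unfolding join_def Lattice.sup_def using lub[OF that] least_unique by (blast intro: some_equality)
  show "f I \<sqinter>\<^bsub>G\<^esub> f J = f (I \<inter> J)" if "I \<in> L" "J \<in> L"
    unfolding meet_def Lattice.inf_def using glb[OF that] greatest_unique by (blast intro: some_equality)
qed

lemma inclusion_order_lattice:
  assumes "\<And>I J. I \<in> L \<Longrightarrow> J \<in> L \<Longrightarrow> I \<union> J \<in> L \<and> I \<inter> J \<in> L"
  shows "lattice (inclusion_order L)"
    and "I \<in> L \<Longrightarrow> J \<in> L \<Longrightarrow> I \<squnion>\<^bsub>inclusion_order L\<^esub> J = I \<union> J"
    and "I \<in> L \<Longrightarrow> J \<in> L \<Longrightarrow> I \<sqinter>\<^bsub>inclusion_order L\<^esub> J = I \<inter> J"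
  using assms lattice_image_of_set_lattice[of "inclusion_order L" "\<lambda>I. I" L]
  by (simp_all add: inclusion_order_def)

section \<open>Two presentations of one matroid\<close>

locale two_presentations =
  fixes E :: "'a set" and r :: nat and x :: 'a and A B :: "nat \<Rightarrow> 'a set"
  assumes finite_E: "finite E" and x_notin: "x \<notin> E"
    and A_subset: "\<And>i. i \<in> {1..r} \<Longrightarrow> A i \<subseteq> E" and B_subset: "\<And>i. i \<in> {1..r} \<Longrightarrow> B i \<subseteq> E"
    and same_matroid: "\<And>X. X \<subseteq> E \<Longrightarrow> partial_transversal r A X \<longleftrightarrow> partial_transversal r B X"
begin

lemma swap: "two_presentations E r x B A"
  by unfold_locales (use finite_E x_notin A_subset B_subset same_matroid in auto)

lemma ext_matroid_inj_on: "inj_on (ext_matroid E r x A) (L_sets E r x A)"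
proof (rule inj_onI)
  fix I J assume IJ: "I \<in> L_sets E r x A" "J \<in> L_sets E r x A"
    "ext_matroid E r x A I = ext_matroid E r x A J"
  have sub: "I \<subseteq> {1..r}" "J \<subseteq> {1..r}" using IJ by (auto simp: L_sets_def)
  show "I = J"
    using weak_le_ext_matroid_iff[OF x_notin A_subset sub(1) IJ(2)]
      weak_le_ext_matroid_iff[OF x_notin A_subset sub(2) IJ(1)] IJ(3) by (simp add: weak_le_def)
qed

lemma ext_matroid_Int_eq:
  assumes "I1 \<in> L_sets E r x A" "I2 \<in> L_sets E r x A" "J1 \<in> L_sets E r x B" "J2 \<in> L_sets E r x B"
    and "ext_matroid E r x A I1 = ext_matroid E r x B J1"
      "ext_matroid E r x A I2 = ext_matroid E r x B J2"
  shows "ext_matroid E r x A (I1 \<inter> I2) = ext_matroid E r x B (J1 \<inter> J2)"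
proof (rule ext_matroid_eqI, rule antisym)
  have sub: "I1 \<subseteq> {1..r}" "I2 \<subseteq> {1..r}" "J1 \<subseteq> {1..r}" "J2 \<subseteq> {1..r}"
    using assms by (auto simp: L_sets_def)
  show "indep (ext_matroid E r x A (I1 \<inter> I2)) \<subseteq> indep (ext_matroid E r x B (J1 \<inter> J2))"
    using indep_ext_matroid_Int_le[OF finite_E x_notin B_subset A_subset same_matroid[symmetric]
        assms(3,4) sub(1,2) assms(5,6)[symmetric]] .
  show "indep (ext_matroid E r x B (J1 \<inter> J2)) \<subseteq> indep (ext_matroid E r x A (I1 \<inter> I2))"
    using indep_ext_matroid_Int_le[OF finite_E x_notin A_subset B_subset same_matroid
        assms(1,2) sub(3,4) assms(5,6)] .
qed

lemma ext_matroid_Un_eq: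
  assumes "ext_matroid E r x A I1 = ext_matroid E r x B J1"
    "ext_matroid E r x A I2 = ext_matroid E r x B J2"
  shows "ext_matroid E r x A (I1 \<union> I2) = ext_matroid E r x B (J1 \<union> J2)"
  using assms by (intro ext_matroid_eqI) (simp add: indep_ext_matroid_Un)

lemma L_common_closed:
  assumes "I1 \<in> L_common E r x A B" "I2 \<in> L_common E r x A B"
  shows "I1 \<union> I2 \<in> L_common E r x A B \<and> I1 \<inter> I2 \<in> L_common E r x A B"
proof -
  obtain J1 J2 where I: "I1 \<in> L_sets E r x A" "I2 \<in> L_sets E r x A"
    and J: "J1 \<in> L_sets E r x B" "J2 \<in> L_sets E r x B"
    and eq: "ext_matroid E r x A I1 = ext_matroid E r x B J1"
      "ext_matroid E r x A I2 = ext_matroid E r x B J2"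
    using assms unfolding L_common_def by blast
  show ?thesis
    using L_sets_closed[OF finite_E I] L_sets_closed[OF finite_E J]
      ext_matroid_Un_eq[OF eq] ext_matroid_Int_eq[OF I J eq]
    unfolding L_common_def by blast
qed

text \<open>Adding \<open>x\<close> to all sets gives the free extension: \<open>insert x X\<close> is independent iff \<open>X\<close> is and
  some index is left unmatched.\<close>

lemma indep_free_extension_le:
  "indep (ext_matroid E r x A {1..r}) \<subseteq> indep (ext_matroid E r x B {1..r})"
proof
  fix Y assume "Y \<in> indep (ext_matroid E r x A {1..r})"
  then have Y: "Y \<subseteq> insert x E" "partial_transversal r (extend_system x A {1..r}) Y"
    by (simp_all add: indep_ext_matroid)
  define X where "X = Y - {x}"
  have X: "X \<subseteq> E" "x \<notin> X" using Y(1) by (auto simp: X_def)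
  have "partial_transversal r (extend_system x A {1..r}) X"
    using Y(2) by (rule partial_transversal_subset) (auto simp: X_def)
  then have pX: "partial_transversal r B X"
    using X same_matroid by (simp add: partial_transversal_extend_avoiding)
  have "partial_transversal r (extend_system x B {1..r}) Y"
  proof (cases "x \<in> Y")
    case False
    then show ?thesis using pX by (simp add: X_def partial_transversal_extend_avoiding)
  next
    case True
    obtain f where f: "inj_on f X" "f ` X \<subseteq> {1..r}" "\<forall>e\<in>X. e \<in> B (f e)"
      using pX by (rule partial_transversalE)
    \<comment> \<open>Since \<open>Y\<close> has at most \<open>r\<close> elements, \<open>X\<close>
      occupies fewer than \<open>r\<close> indices, and some \<open>k\<close> is left for
      \<open>x\<close>.\<close>
    have "card Y \<le> card (nbrs r (extend_system x A {1..r}) Y)"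
      using Y(2) by (rule partial_transversal_card_le)
    also have "\<dots> \<le> card {1..r}" by (intro card_mono) (auto simp: nbrs_def)
    finally have "card (f ` X) < card {1..r}"
      using f(1) True partial_transversal_finite[OF Y(2)] card_Diff1_less[of Y x]
      by (simp add: card_image X_def)
    then obtain k where k: "k \<in> {1..r}" "k \<notin> f ` X" using f(2) by (metis less_irrefl subset_antisym subsetI)
    have "partial_transversal r (on_indices (extend_system x B {1..r}) (- {k})) X"
      using f k X(2)
      by (intro partial_transversalI[of f]) (auto simp: on_indices_def extend_system_def)
    then have "partial_transversal r (extend_system x B {1..r}) (insert x X)"
      using k(1) by (intro partial_transversal_insert[of r _ k]) (auto simp: extend_system_def)
    then show ?thesis using True by (simp add: X_def insert_absorb)
  qed
  then show "Y \<in> indep (ext_matroid E r x B {1..r})" using Y(1) by (simp add: indep_ext_matroid)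
qed

end

section \<open>The sublattices and their isomorphism\<close>

context two_presentations
begin

interpretation swapped: two_presentations E r x B A by (rule swap)

text \<open>A sublattice must be nonempty; the free extension is common to both
  presentations.\<close>

lemma L_common_nonempty: "{1..r} \<in> L_common E r x A B"
proof -
  have "{1..r} \<in> L_sets E r x F" for F by (auto simp: L_sets_def ext_closure_def)
  moreover have "ext_matroid E r x A {1..r} = ext_matroid E r x B {1..r}"
    using indep_free_extension_le swapped.indep_free_extension_le by (intro ext_matroid_eqI) auto
  ultimately show ?thesis unfolding L_common_def by blast
qed

lemma sublattice_L_common:
  "sublattice (L_common E r x A B) (inclusion_order (L_sets E r x A))"
proof -
  have "L_common E r x A B \<subseteq> L_sets E r x A" by (auto simp: L_common_def)
  then show ?thesis
    using L_common_nonempty L_common_closed join_meet_L_sets[OF finite_E, of _ r x A]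
      lattice_L_sets[OF finite_E]
    unfolding sublattice_def by (auto simp: inclusion_order_def subset_iff)
qed

lemma T_exts_Int: "T_exts E r x A \<inter> T_exts E r x B = ext_matroid E r x A ` L_common E r x A B"
  unfolding T_exts_def L_common_def by auto

lemma sublattice_T_exts:
  "sublattice (T_exts E r x A \<inter> T_exts E r x B) (weak_order (T_exts E r x A))"
proof -
  have sub: "I \<subseteq> {1..r}" if "I \<in> L_sets E r x A" for I using that by (simp add: L_sets_def)
  have G: "carrier (weak_order (T_exts E r x A)) = ext_matroid E r x A ` L_sets E r x A"
    "eq (weak_order (T_exts E r x A)) = (=)"
    by (simp_all add: weak_order_def T_exts_def)
  have le: "le (weak_order (T_exts E r x A)) (ext_matroid E r x A I) (ext_matroid E r x A J) \<longleftrightarrow> I \<subseteq> J"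
    if "I \<in> L_sets E r x A" "J \<in> L_sets E r x A" for I J
    using weak_le_ext_matroid_iff[OF x_notin A_subset sub[OF that(1)] that(2)]
    by (simp add: weak_order_def)
  have closed: "I \<union> J \<in> L_sets E r x A \<and> I \<inter> J \<in> L_sets E r x A"
    if "I \<in> L_sets E r x A" "J \<in> L_sets E r x A" for I J
    using L_sets_closed[OF finite_E that] by blast
  note lat = lattice_image_of_set_lattice[OF G closed le]
  have sub: "L_common E r x A B \<subseteq> L_sets E r x A" by (auto simp: L_common_def)
  show ?thesis
    unfolding sublattice_def T_exts_Int
  proof (intro conjI ballI)
    show "ext_matroid E r x A ` L_common E r x A B \<noteq> {}" using L_common_nonempty by blast
    show "ext_matroid E r x A ` L_common E r x A B \<subseteq> carrier (weak_order (T_exts E r x A))"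
      using sub unfolding G by blast
  next
    fix M N assume "M \<in> ext_matroid E r x A ` L_common E r x A B" "N \<in> ext_matroid E r x A ` L_common E r x A B"
    then obtain I J where IJ: "I \<in> L_common E r x A B" "J \<in> L_common E r x A B"
      and MN: "M = ext_matroid E r x A I" "N = ext_matroid E r x A J" by blast
    have IJ': "I \<in> L_sets E r x A" "J \<in> L_sets E r x A" using IJ sub by blast+
    show "M \<squnion>\<^bsub>weak_order (T_exts E r x A)\<^esub> N \<in> ext_matroid E r x A ` L_common E r x A B"
      "M \<sqinter>\<^bsub>weak_order (T_exts E r x A)\<^esub> N \<in> ext_matroid E r x A ` L_common E r x A B"
      unfolding MN using lat(2,3)[OF _ _ _ _ IJ'] L_common_closed[OF IJ] by auto
  qed (rule lat(1))
qed

text \<open>The isomorphism sends \<open>I\<close> to the closed index set that gives the same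
  extension from \<open>B\<close>. Unions and intersections of matching index sets match
  again.\<close>

lemma lattice_isomorphic_L_common:
  "lattice_isomorphic (inclusion_order (L_common E r x A B)) (inclusion_order (L_common E r x B A))"
proof -
  let ?L = "L_common E r x A B" and ?K = "L_common E r x B A"
  have "\<forall>I\<in>?L. \<exists>J. J \<in> L_sets E r x B \<and> ext_matroid E r x A I = ext_matroid E r x B J"
    unfolding L_common_def by blast
  then obtain h where h: "\<And>I. I \<in> ?L \<Longrightarrow> h I \<in> L_sets E r x B"
    "\<And>I. I \<in> ?L \<Longrightarrow> ext_matroid E r x A I = ext_matroid E r x B (h I)"
    by metis
  have LA: "I \<in> L_sets E r x A" if "I \<in> ?L" for I using that by (simp add: L_common_def)
  have hK: "h I \<in> ?K" if "I \<in> ?L" for I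
    using h(1)[OF that] h(2)[OF that] LA[OF that] unfolding L_common_def by (auto intro: sym)
  \<comment> \<open>The value \<open>h I\<close> was merely chosen; injectivity on closed sets makes
    it the only candidate.\<close>
  have h_eq: "h I = J" if "I \<in> ?L" "J \<in> L_sets E r x B" "ext_matroid E r x A I = ext_matroid E r x B J" for I J
    using swapped.ext_matroid_inj_on h[OF that(1)] that(2,3) by (metis inj_onD)
  have "inj_on h ?L"
    using ext_matroid_inj_on LA h(2) by (metis inj_on_def)
  moreover have "J \<in> h ` ?L" if J: "J \<in> ?K" for J
  proof -
    obtain I where I: "I \<in> L_sets E r x A" "ext_matroid E r x B J = ext_matroid E r x A I"
      and JB: "J \<in> L_sets E r x B"
      using J unfolding L_common_def by blast
    have "I \<in> ?L" using I JB unfolding L_common_def by (auto intro: sym)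
    then show ?thesis using h_eq[OF _ JB] I(2) by force
  qed
  ultimately have "bij_betw h ?L ?K" using hK by (auto simp: bij_betw_def)
  moreover have "h (I \<union> J) = h I \<union> h J" "h (I \<inter> J) = h I \<inter> h J" if IJ: "I \<in> ?L" "J \<in> ?L" for I J
  proof -
    note hB = h(1)[OF IJ(1)] h(1)[OF IJ(2)] and eq = h(2)[OF IJ(1)] h(2)[OF IJ(2)]
    show "h (I \<union> J) = h I \<union> h J"
      using L_common_closed[OF IJ] L_sets_closed(1)[OF finite_E hB] ext_matroid_Un_eq[OF eq]
      by (intro h_eq) auto
    show "h (I \<inter> J) = h I \<inter> h J"
      using L_common_closed[OF IJ] L_sets_closed(2)[OF finite_E hB]
        ext_matroid_Int_eq[OF LA[OF IJ(1)] LA[OF IJ(2)] hB eq]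
      by (intro h_eq) auto
  qed
  moreover have "carrier (inclusion_order S) = S" for S :: "nat set set"
    by (simp add: inclusion_order_def)
  ultimately show ?thesis
    unfolding lattice_isomorphic_def join_pres_def meet_pres_def
    using inclusion_order_lattice[of ?L, OF L_common_closed]
      inclusion_order_lattice[of ?K, OF swapped.L_common_closed] hK
    by (intro exI[of _ h]) simp
qed

end

theorem theorem3p14:
  fixes M :: "'a matroid" and A B :: "nat \<Rightarrow> 'a set" and E :: "'a set" and r :: nat and x :: 'a
  assumes "E = ground M" and "r = matroid_rank M"
    and "presentation A M" and "presentation B M"
    and "x \<notin> E"
  shows "sublattice (L_common E r x A B) (inclusion_order (L_sets E r x A)) \<and>
    sublattice (L_common E r x B A) (inclusion_order (L_sets E r x B)) \<and>
    lattice_isomorphic (inclusion_order (L_common E r x A B)) (inclusion_order (L_common E r x B A)) \<and>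
    sublattice (T_exts E r x A \<inter> T_exts E r x B) (weak_order (T_exts E r x A)) \<and>
    sublattice (T_exts E r x A \<inter> T_exts E r x B) (weak_order (T_exts E r x B))"
proof -
  have M: "M = transversal_matroid E r A" "M = transversal_matroid E r B"
    using assms unfolding presentation_def by auto
  have indep: "indep (transversal_matroid E r F) = {X. X \<subseteq> E \<and> partial_transversal r F X}" for F
    by (simp add: transversal_matroid_def)
  interpret two_presentations E r x A B
  proof
    show "partial_transversal r A X \<longleftrightarrow> partial_transversal r B X" if "X \<subseteq> E" for X
      using that indep[of A] indep[of B] M by (metis (no_types, lifting) mem_Collect_eq)
  qed (use assms in \<open>auto simp: presentation_def\<close>)
  interpret swapped: two_presentations E r x B A by (rule swap)
  show ?thesis
    using sublattice_L_common swapped.sublattice_L_common lattice_isomorphic_L_common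
      sublattice_T_exts swapped.sublattice_T_exts by (simp add: Int_commute)
qed

end
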